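(* Let $q$ be a real-valued, $1$-periodic function with $q\in L_1[0,1]$ and $\int_0^1 q(x)\,dx=0$. Let $\lambda_{n,1}\le\lambda_{n,2}$ be the large periodic eigenvalues and let $\alpha_{n,j}$ be the quantities defined in the context. Then: (a) The eigenvalues $\lambda_{n,1}$ and $\lambda_{n,2}$ satisfy $$\lambda_{n,j}-(2\pi n)^2=a_j|q_{2n}|+O(\alpha_{n,j})$$ for $j=1,2$ as $n\to\infty$, where $a_j$ (which may depend on $n$) is either $1$ or $-1$. (b) If $|q_{2n}|\gg|\alpha_{n,1}|+|\alpha_{n,2}|$ for all large $n$ (that is, $q_{2n}\neq0$ for all large $n$ and $(|\alpha_{n,1}|+|\alpha_{n,2}|)/|q_{2n}|\to0$ as $n\to\infty$), then there is $N$ such that the eigenvalues $\lambda_{n,j}$ for $j=1,2$ and $n\ge N$ are simple, and they satisfy $$\lambda_{n,j}=(2\pi n)^2+(-1)^j|q_{2n}|+o\left(\frac1n\right)$$ as $n\to\infty$.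
   Context: $L_0(q)$ is the operator in $L_2[0,1]$ generated by $-y''+qy$ with periodic boundary conditions $y(1)=y(0)$, $y'(1)=y'(0)$. Its large eigenvalues, counted with multiplicity, form two sequences $\lambda_{n,1}\le\lambda_{n,2}$ ($n\ge N_0$, $N_0$ a sufficiently large integer) with $\lambda_{n,j}=(2\pi n)^2+O(n^{1/2})$. $(\cdot,\cdot)$ is the inner product of $L_2[0,1]$ and $q_k=(q,e^{i2\pi kx})=\int_0^1q(x)e^{-i2\pi kx}dx$. $\Psi_{n,j}$ is a real-valued eigenfunction of $L_0(q)$ for $\lambda_{n,j}$ with $L_2[0,1]$-norm $1$; if $\lambda_{n,1}=\lambda_{n,2}$, then $\Psi_{n,1}$ and $\Psi_{n,2}$ are chosen orthogonal. Put $u_{n,j}=(\Psi_{n,j},e^{i2\pi nx})$ and define $\alpha_{n,j}$ by $$(\lambda_{n,j}-(2\pi n)^2)u_{n,j}=q_{2n}\overline{u_{n,j}}+\alpha_{n,j}.$$ (One has $\alpha_{n,j}=o(n^{-1})$.) *)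

theory Defs
  imports "HOL-Analysis.Analysis" "HOL-Library.Landau_Symbols" "HOL-Library.Function_Algebras"
begin

definition ip01 :: "(real \<Rightarrow> complex) \<Rightarrow> (real \<Rightarrow> complex) \<Rightarrow> complex" where
  "ip01 f g = integral {0..1} (\<lambda>x. f x * cnj (g x))"

definition norm01 :: "(real \<Rightarrow> complex) \<Rightarrow> real" where
  "norm01 f = sqrt (integral {0..1} (\<lambda>x. (cmod (f x))\<^sup>2))"

definition square_integrable01 :: "(real \<Rightarrow> complex) \<Rightarrow> bool" where
  "square_integrable01 f \<longleftrightarrow>
     f \<in> borel_measurable (lebesgue_on {0..1}) \<and>
     (\<lambda>x. (cmod (f x))\<^sup>2) absolutely_integrable_on {0..1}"

definition efun :: "int \<Rightarrow> real \<Rightarrow> complex" where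
  "efun k x = exp (\<i> * of_real (2 * pi * of_int k * x))"

definition qcoeff :: "(real \<Rightarrow> real) \<Rightarrow> int \<Rightarrow> complex" where
  "qcoeff q k = ip01 (\<lambda>x. complex_of_real (q x)) (efun k)"

text \<open>
  \<open>f\<close> is absolutely continuous on \<open>[0,1]\<close>, with derivative \<open>g\<close> almost everywhere,
  expressed through the fundamental theorem of calculus for the Lebesgue integral.
\<close>

definition abs_cont_deriv :: "(real \<Rightarrow> complex) \<Rightarrow> (real \<Rightarrow> complex) \<Rightarrow> bool" where
  "abs_cont_deriv f g \<longleftrightarrow>
     g absolutely_integrable_on {0..1} \<and>
     (\<forall>x\<in>{0..1}. f x = f 0 + integral {0..x} g)"

text \<open>
  The graph of the periodic operator: \<open>y\<close> is in the domain and \<open>f = - y'' + q y\<close> in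
  \<open>L\<^sub>2[0,1]\<close>.  The auxiliary functions \<open>y1\<close> and \<open>y2\<close> are \<open>y'\<close> and \<open>y''\<close>; since \<open>y1\<close> is
  continuous, it is the classical derivative of \<open>y\<close> on the whole of \<open>[0,1]\<close> (one-sided at
  the end points).  Elements of the domain are functions on \<open>[0,1]\<close>, represented as
  functions on the real line that vanish outside that interval, so that functions
  differing only outside \<open>[0,1]\<close> are not counted as distinct.
\<close>

definition periodic_op :: "(real \<Rightarrow> real) \<Rightarrow> (real \<Rightarrow> complex) \<Rightarrow> (real \<Rightarrow> complex) \<Rightarrow> bool" where
  "periodic_op q y f \<longleftrightarrow>
     (\<forall>x. x \<notin> {0..1} \<longrightarrow> y x = 0) \<and>
     square_integrable01 f \<and>
     (\<exists>y1 y2. abs_cont_deriv y y1 \<and> abs_cont_deriv y1 y2 \<and>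
        y 1 = y 0 \<and> y1 1 = y1 0 \<and>
        (AE x in lebesgue_on {0..1}. f x = - y2 x + complex_of_real (q x) * y x))"

definition eigenspace :: "(real \<Rightarrow> real) \<Rightarrow> real \<Rightarrow> (real \<Rightarrow> complex) set" where
  "eigenspace q \<mu> = {y. periodic_op q y (\<lambda>x. complex_of_real \<mu> * y x)}"

definition fscale :: "complex \<Rightarrow> (real \<Rightarrow> complex) \<Rightarrow> (real \<Rightarrow> complex)" where
  "fscale c f = (\<lambda>x. c * f x)"

lemma vector_space_fscale: "vector_space fscale"
  by unfold_locales (auto simp: fscale_def fun_eq_iff algebra_simps)

text \<open>
  The operator is self-adjoint, so the multiplicity of an eigenvalue is the (complex)
  dimension of its eigenspace; it is \<open>0\<close> if \<open>\<mu>\<close> is not an eigenvalue.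
\<close>

definition eig_mult :: "(real \<Rightarrow> real) \<Rightarrow> real \<Rightarrow> nat" where
  "eig_mult q \<mu> = vector_space.dim fscale (eigenspace q \<mu>)"

text \<open>
  The numbers \<open>lam n 1 \<le> lam n 2\<close>, \<open>n \<ge> N0\<close>, are exactly the eigenvalues above some
  threshold \<open>M\<close>, each listed as often as its multiplicity.  The values of \<open>lam n j\<close> with
  \<open>n < N0\<close> or \<open>j \<notin> {1, 2}\<close> are irrelevant.
\<close>

definition large_periodic_eigenvalues ::
    "(real \<Rightarrow> real) \<Rightarrow> nat \<Rightarrow> (nat \<Rightarrow> nat \<Rightarrow> real) \<Rightarrow> bool" where
  "large_periodic_eigenvalues q N0 lam \<longleftrightarrow>
     (\<forall>n\<ge>N0. lam n 1 \<le> lam n 2) \<and>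
     (\<forall>j\<in>{1, 2}. (\<lambda>n. lam n j - (2 * pi * real n)\<^sup>2) \<in> O(\<lambda>n. sqrt (real n))) \<and>
     (\<exists>M. (\<forall>n\<ge>N0. \<forall>j\<in>{1, 2}. lam n j > M) \<and>
          (\<forall>\<mu>>M. eig_mult q \<mu> = card {(n, j). n \<ge> N0 \<and> j \<in> {1, 2} \<and> lam n j = \<mu>}))"

end

theory Submission
  imports Defs
begin

text \<open>
  Fix a mode number \<open>n\<close>, put \<open>\<omega> = 2\<pi>n\<close> and \<open>e\<^sub>k(x) = exp(2\<pi>ikx)\<close>, and let \<open>y\<close> be a normalized
  real eigenfunction with eigenvalue \<open>\<omega>\<^sup>2 + \<delta>\<close>, \<open>\<delta> = O(n\<^sup>1\<^sup>/\<^sup>2)\<close>.  Then \<open>y'' + \<omega>\<^sup>2 y = h\<close> with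
  \<open>h = (q - \<delta>) y\<close>, and variation of constants gives \<open>y = A e\<^sub>n + B e\<^sub>-\<^sub>n + R / \<omega>\<close>, where \<open>|R|\<close> is at
  most \<open>(\<parallel>q\<parallel>\<^sub>1 + |\<delta>|) sup|y|\<close>.  The coefficients \<open>A\<close>, \<open>B\<close> differ from \<open>u = (y, e\<^sub>n)\<close> and
  \<open>(y, e\<^sub>-\<^sub>n)\<close>, which is the conjugate of \<open>u\<close>, by at most this bound over \<open>\<omega>\<close>.  Hence \<open>sup|y|\<close> is at most
  about \<open>2|u|\<close>; since \<open>sup|y| \<ge> \<parallel>y\<parallel>\<^sub>2 = 1\<close>, the numbers \<open>|u|\<close> stay away from \<open>0\<close>
  (\<open>normalized_eigenfunction_bounds\<close>).

  Part (a) is then immediate: taking moduli in \<open>\<delta> u = q\<^sub>2\<^sub>n cnj u + \<alpha>\<close> and dividing by \<open>|u|\<close>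
  shows \<open>||\<delta>| - |q\<^sub>2\<^sub>n|| \<le> 4|\<alpha>|\<close> (\<open>coupling_modulus\<close>), and \<open>a\<close> is the sign of \<open>\<delta>\<close>.

  Part (b) needs two more facts.

  \<^item> \<open>\<alpha> = o(1/n)\<close> (\<open>coupling_fine\<close>, \<open>eigenpair_asymptotics\<close>).  Up to negligible terms, \<open>\<omega> \<alpha>\<close> is
    the integral of \<open>q R e\<^sub>-\<^sub>n\<close>.  Replacing \<open>y\<close> by its two modes inside \<open>R\<close> turns it into a
    combination of double integrals of \<open>q(x) q(t)\<close> over \<open>t < x\<close>.  The only one without an
    oscillating factor equals half the square of the mean of \<open>q\<close> and vanishes; the others are
    dominated by the integral of \<open>|q|\<close> times the modulus of an oscillating primitive of \<open>q\<close>,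
    which tends to \<open>0\<close> by the Riemann--Lebesgue lemma and dominated convergence.

  \<^item> The two shifts \<open>\<delta>\<^sub>1 \<le> \<delta>\<^sub>2\<close> have opposite signs.  Eliminating \<open>q\<^sub>2\<^sub>n\<close> from the relations for
    \<open>j = 1, 2\<close> and taking imaginary parts bounds \<open>(\<delta>\<^sub>1 + \<delta>\<^sub>2) Im(u\<^sub>1 cnj u\<^sub>2)\<close> by a multiple of
    \<open>|\<alpha>\<^sub>1| + |\<alpha>\<^sub>2|\<close> (\<open>coupling_sum\<close>).  The eigenfunctions are orthogonal and consist essentially of
    the modes \<open>e\<^sub>n\<close> and \<open>e\<^sub>-\<^sub>n\<close>, so \<open>2 Re(u\<^sub>1 cnj u\<^sub>2)\<close> tends to \<open>0\<close>; as \<open>|u\<^sub>1 cnj u\<^sub>2|\<close> is bounded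
    below, so is \<open>|Im(u\<^sub>1 cnj u\<^sub>2)|\<close>.  Thus \<open>\<delta>\<^sub>1 + \<delta>\<^sub>2\<close> is small against \<open>|q\<^sub>2\<^sub>n|\<close> although
    \<open>|\<delta>\<^sub>1|\<close> and \<open>|\<delta>\<^sub>2|\<close> are both close to \<open>|q\<^sub>2\<^sub>n|\<close>.

  Consequently \<open>\<delta>\<^sub>1 < 0 < \<delta>\<^sub>2\<close>, so the two eigenvalues of a pair differ; pairs with different
  mode numbers are far apart because \<open>\<delta>\<close> tends to \<open>0\<close>, and simplicity follows by counting.
\<close>

section \<open>Products of absolutely continuous functions\<close>

lemma absolutely_integrable_mult_continuous:
  fixes f g :: "real \<Rightarrow> complex"
  assumes "f absolutely_integrable_on {a..b}" "continuous_on {a..b} g"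
  shows "(\<lambda>x. f x * g x) absolutely_integrable_on {a..b}"
proof -
  have "(\<lambda>x. g x * f x) absolutely_integrable_on {a..b}"
  proof (rule absolutely_integrable_bounded_measurable_product[where h = "(*)"])
    show "bilinear ((*) :: complex \<Rightarrow> complex \<Rightarrow> complex)"
      by (rule bilinear_times)
    show "g \<in> borel_measurable (lebesgue_on {a..b})"
      using assms(2) by (simp add: continuous_imp_measurable_on_sets_lebesgue)
    show "bounded (g ` {a..b})"
      by (intro compact_imp_bounded compact_continuous_image assms(2) compact_Icc)
  qed (use assms(1) in auto)
  thus ?thesis by (simp add: mult.commute)
qed

lemma absolutely_integrable_integrable:
  fixes f :: "real \<Rightarrow> 'a::euclidean_space"
  assumes "f absolutely_integrable_on {a..b}" "{c..d} \<subseteq> {a..b}"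
  shows "f integrable_on {c..d}" "(\<lambda>x. norm (f x)) integrable_on {c..d}"
  using absolutely_integrable_on_subinterval[OF assms]
  by (auto simp: absolutely_integrable_on_def)

lemma abs_cont_derivD:
  assumes "abs_cont_deriv f g"
  shows "g absolutely_integrable_on {0..1}"
    and "x \<in> {0..1} \<Longrightarrow> f x = f 0 + integral {0..x} g"
  using assms unfolding abs_cont_deriv_def by blast+

lemma abs_cont_deriv_continuous:
  assumes "abs_cont_deriv f g"
  shows "continuous_on {0..1} f"
proof -
  have "continuous_on {0..1} (\<lambda>x. f 0 + integral {0..x} g)"
    using abs_cont_derivD(1)[OF assms]
    by (intro continuous_intros indefinite_integral_continuous_1)
      (simp add: absolutely_integrable_on_def)
  thus ?thesis
    by (rule continuous_on_eq) (rule abs_cont_derivD(2)[OF assms, symmetric])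
qed

lemma abs_cont_deriv_increment:
  assumes "abs_cont_deriv f g" "0 \<le> s" "s \<le> t" "t \<le> 1"
  shows "f t - f s = integral {s..t} g"
proof -
  have "g integrable_on {0..t}"
    using absolutely_integrable_integrable(1)[OF abs_cont_derivD(1)[OF assms(1)], of 0 t] assms by auto
  from Henstock_Kurzweil_Integration.integral_combine[OF assms(2,3) this]
  have "integral {0..t} g = integral {0..s} g + integral {s..t} g" by (rule sym)
  moreover have "f t = f 0 + integral {0..t} g" "f s = f 0 + integral {0..s} g"
    using assms by (auto intro!: abs_cont_derivD(2)[OF assms(1)])
  ultimately show ?thesis by simp
qed

lemma abs_cont_deriv_cong_AE:
  assumes "abs_cont_deriv f g" "AE x in lebesgue_on {0..1}. h x = g x"
  shows "abs_cont_deriv f h"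
proof -
  from assms(2) have "AE x in lebesgue. x \<in> {0..1} \<longrightarrow> h x = g x"
    by (simp add: AE_restrict_space_iff)
  then obtain N where N: "N \<in> null_sets lebesgue" "{x. \<not> (x \<in> {0..1} \<longrightarrow> h x = g x)} \<subseteq> N"
    unfolding eventually_ae_filter by auto
  hence neg: "negligible N" by (simp add: negligible_iff_null_sets)
  have eq: "h x = g x" if "x \<in> {0..1} - N" for x using that N(2) by auto
  have "h absolutely_integrable_on {0..1}"
    by (rule absolutely_integrable_spike[OF abs_cont_derivD(1)[OF assms(1)] neg eq])
  moreover have "integral {0..x} h = integral {0..x} g" if "x \<in> {0..1}" for x
    by (rule integral_spike[OF neg]) (use eq that in auto)
  ultimately show ?thesis using assms(1) unfolding abs_cont_deriv_def by metis
qed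

text \<open>
  A replacement for "derivative zero almost everywhere": if the increments of \<open>P\<close> over short
  intervals are arbitrarily small compared with those of some fixed \<open>V\<close>, then adding them up
  along a uniform partition of \<open>[0,x]\<close> leaves at most \<open>e * (V x - V 0)\<close> for every \<open>e\<close>.
\<close>

lemma constant_of_small_increments:
  fixes P :: "real \<Rightarrow> complex" and V :: "real \<Rightarrow> real"
  assumes small: "\<And>e. e > 0 \<Longrightarrow> \<exists>d>0. \<forall>s\<in>{0..1}. \<forall>t\<in>{0..1}. s \<le> t \<and> t - s < d \<longrightarrow>
      norm (P t - P s) \<le> e * (V t - V s)"
    and x: "x \<in> {0..1}"
  shows "P x = P 0"
proof -
  have *: "norm (P x - P 0) \<le> e * (V x - V 0)" if e: "e > 0" for e
  proof -
    obtain d where d: "d > 0" and D: "\<And>s t. s \<in> {0..1} \<Longrightarrow> t \<in> {0..1} \<Longrightarrow> s \<le> t \<Longrightarrow> t - s < d \<Longrightarrow>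
      norm (P t - P s) \<le> e * (V t - V s)"
      using small[OF e] by blast
    \<comment> \<open>the partition points are \<open>i x / N\<close>, with mesh below \<open>d\<close>\<close>
    obtain N :: nat where N: "1 / d < real N" using reals_Archimedean2 by blast
    have "0 < real N" using N d by (meson divide_pos_pos less_trans zero_less_one)
    hence N0: "N > 0" by simp
    have "1 < d * real N" using N d by (simp add: field_simps)
    have pt: "real i * x / N \<in> {0..1}" if "i \<le> N" for i
    proof -
      have "real i * x \<le> real N * 1" using that x by (intro mult_mono) auto
      thus ?thesis using x N0 by (auto simp: field_simps)
    qed
    have "norm (P (real i * x / N) - P 0) \<le> e * (V (real i * x / N) - V 0)" if "i \<le> N" for i
      using that
    proof (induction i)
      case (Suc i)
      have "real (Suc i) * x / N - real i * x / N = x / N"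
        by (simp add: ring_distribs add_divide_distrib)
      also have "\<dots> \<le> 1 / N" using x by (intro divide_right_mono) auto
      also have "\<dots> < d" using \<open>1 < d * real N\<close> N0 by (simp add: field_simps)
      finally have lt: "real (Suc i) * x / N - real i * x / N < d" .
      have le: "real i * x / N \<le> real (Suc i) * x / N"
        using x by (intro divide_right_mono mult_right_mono) auto
      have 1: "norm (P (real (Suc i) * x / N) - P (real i * x / N))
        \<le> e * (V (real (Suc i) * x / N) - V (real i * x / N))"
        by (rule D[OF pt pt le lt]) (use Suc.prems in auto)
      have 2: "norm (P (real i * x / N) - P 0) \<le> e * (V (real i * x / N) - V 0)"
        using Suc by simp
      have "norm (P (real (Suc i) * x / N) - P 0) \<le>
         norm (P (real (Suc i) * x / N) - P (real i * x / N)) + norm (P (real i * x / N) - P 0)"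
        using norm_triangle_ineq[of "P (real (Suc i) * x / N) - P (real i * x / N)" "P (real i * x / N) - P 0"]
        by simp
      also have "\<dots> \<le> e * (V (real (Suc i) * x / N) - V 0)"
        using 1 2 by (simp add: algebra_simps)
      finally show ?case .
    qed simp
    from this[of N] N0 show ?thesis by simp
  qed
  have "norm (P x - P 0) \<le> 0"
  proof (rule field_le_epsilon)
    fix e :: real assume "e > 0"
    define c where "c = e / (\<bar>V x - V 0\<bar> + 1)"
    have "c > 0" using \<open>e > 0\<close> by (simp add: c_def)
    have "norm (P x - P 0) \<le> c * (V x - V 0)" by (rule *[OF \<open>c > 0\<close>])
    also have "\<dots> \<le> c * (\<bar>V x - V 0\<bar> + 1)" using \<open>c > 0\<close> by (intro mult_left_mono) auto
    also have "\<dots> = e" by (simp add: c_def)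
    finally show "norm (P x - P 0) \<le> 0 + e" by simp
  qed
  thus ?thesis by simp
qed

lemma norm_integral_mult_le:
  fixes f g :: "real \<Rightarrow> complex"
  assumes "f absolutely_integrable_on {a..b}" "continuous_on {a..b} g"
    and "\<And>x. x \<in> {a..b} \<Longrightarrow> norm (g x) \<le> C"
  shows "norm (integral {a..b} (\<lambda>x. f x * g x)) \<le> C * integral {a..b} (\<lambda>x. norm (f x))"
proof -
  have "norm (integral {a..b} (\<lambda>x. f x * g x)) \<le> integral {a..b} (\<lambda>x. C * norm (f x))"
  proof (rule Henstock_Kurzweil_Integration.integral_norm_bound_integral)
    show "(\<lambda>x. f x * g x) integrable_on {a..b}"
      using absolutely_integrable_mult_continuous[OF assms(1,2)] by (simp add: absolutely_integrable_on_def)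
    show "(\<lambda>x. C * norm (f x)) integrable_on {a..b}"
      using assms(1) by (intro integrable_on_mult_right) (simp add: absolutely_integrable_on_def)
    show "norm (f x * g x) \<le> C * norm (f x)" if "x \<in> {a..b}" for x
      using mult_right_mono[OF assms(3)[OF that], of "norm (f x)"] by (simp add: norm_mult mult.commute)
  qed
  thus ?thesis by simp
qed

text \<open>
  The product rule for functions that are only absolutely continuous; all integrations by parts
  below rest on it.  The difference \<open>P\<close> of the two sides has, over \<open>[s,t]\<close>, the increment
  \<open>\<integral> f' (g t - g x) dx + \<integral> g' (f s - f x) dx\<close>, and uniform continuity of \<open>f\<close> and \<open>g\<close> makes it small
  compared with the increment of the primitive of \<open>|f'| + |g'|\<close>.
\<close>

lemma abs_cont_deriv_mult:
  assumes f: "abs_cont_deriv f f'" and g: "abs_cont_deriv g g'"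
  shows "abs_cont_deriv (\<lambda>x. f x * g x) (\<lambda>x. f' x * g x + g' x * f x)"
proof -
  have cf: "continuous_on {0..1} f" and cg: "continuous_on {0..1} g"
    using f g abs_cont_deriv_continuous by auto
  have af: "f' absolutely_integrable_on {0..1}" and ag: "g' absolutely_integrable_on {0..1}"
    using f g by (auto dest: abs_cont_derivD(1))
  let ?h = "\<lambda>x. f' x * g x + g' x * f x"
  have ah: "?h absolutely_integrable_on {0..1}"
    by (intro set_integral_add absolutely_integrable_mult_continuous af ag cf cg)
  define P where "P = (\<lambda>x. f x * g x - integral {0..x} ?h)"
  define v where "v = (\<lambda>x. norm (f' x) + norm (g' x))"
  define V where "V = (\<lambda>x. integral {0..x} v)"
  have iv: "v integrable_on {0..1}"
    unfolding v_def using af ag by (intro integrable_add) (auto simp: absolutely_integrable_on_def)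
  have P: "P x = P 0" if x: "x \<in> {0..1}" for x
  proof (rule constant_of_small_increments[OF _ x, of P V])
    fix e :: real assume e: "e > 0"
    have "uniformly_continuous_on {0..1} f" "uniformly_continuous_on {0..1} g"
      by (auto intro!: compact_uniformly_continuous cf cg)
    then obtain d1 d2 where d: "d1 > 0" "d2 > 0"
      and d1: "\<And>s t. s \<in> {0..1} \<Longrightarrow> t \<in> {0..1} \<Longrightarrow> dist t s < d1 \<Longrightarrow> dist (f t) (f s) < e"
      and d2: "\<And>s t. s \<in> {0..1} \<Longrightarrow> t \<in> {0..1} \<Longrightarrow> dist t s < d2 \<Longrightarrow> dist (g t) (g s) < e"
      using uniformly_continuous_onE[OF _ e] by (metis (no_types))
    show "\<exists>d>0. \<forall>s\<in>{0..1}. \<forall>t\<in>{0..1}. s \<le> t \<and> t - s < d \<longrightarrow> norm (P t - P s) \<le> e * (V t - V s)"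
    proof (intro exI[of _ "min d1 d2"] conjI ballI impI)
      fix s t :: real assume s: "s \<in> {0..1}" and t: "t \<in> {0..1}" and st: "s \<le> t \<and> t - s < min d1 d2"
      have sub: "{s..t} \<subseteq> {0..1}" using s t by auto
      have af': "f' absolutely_integrable_on {s..t}" and ag': "g' absolutely_integrable_on {s..t}"
        using absolutely_integrable_on_subinterval[OF _ sub] af ag by auto
      have cf': "continuous_on {s..t} f" and cg': "continuous_on {s..t} g"
        using cf cg sub continuous_on_subset by blast+
      have int: "f' integrable_on {s..t}" "g' integrable_on {s..t}" 
         "(\<lambda>x. f' x * g x) integrable_on {s..t}" "(\<lambda>x. g' x * f x) integrable_on {s..t}"
         "(\<lambda>x. norm (f' x)) integrable_on {s..t}" "(\<lambda>x. norm (g' x)) integrable_on {s..t}"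
        using af' ag' absolutely_integrable_mult_continuous[OF af' cg'] absolutely_integrable_mult_continuous[OF ag' cf']
        by (auto simp: absolutely_integrable_on_def)
      have Vst: "V t - V s = integral {s..t} (\<lambda>x. norm (f' x)) + integral {s..t} (\<lambda>x. norm (g' x))"
      proof -
        have "v integrable_on {0..t}" by (rule integrable_on_subinterval[OF iv]) (use t in auto)
        from Henstock_Kurzweil_Integration.integral_combine[OF _ _ this, of s] have "V t - V s = integral {s..t} v"
          using s st by (auto simp: V_def)
        thus ?thesis unfolding v_def using int by (simp add: Henstock_Kurzweil_Integration.integral_add)
      qed
      have hst: "integral {0..t} ?h - integral {0..s} ?h = integral {s..t} (\<lambda>x. f' x * g x) + integral {s..t} (\<lambda>x. g' x * f x)"
      proof -
        have "?h integrable_on {0..t}"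
          using absolutely_integrable_integrable(1)[OF ah, of 0 t] t by auto
        from Henstock_Kurzweil_Integration.integral_combine[OF _ _ this, of s] have "integral {0..t} ?h - integral {0..s} ?h = integral {s..t} ?h"
          using s st by (auto simp: algebra_simps)
        thus ?thesis using int by (simp add: Henstock_Kurzweil_Integration.integral_add)
      qed
      have fi: "f t - f s = integral {s..t} f'" "g t - g s = integral {s..t} g'"
        using abs_cont_deriv_increment f g s t st by auto
      have "P t - P s = (f t - f s) * g t + (g t - g s) * f s -
          (integral {s..t} (\<lambda>x. f' x * g x) + integral {s..t} (\<lambda>x. g' x * f x))"
        unfolding hst[symmetric] P_def by (simp add: algebra_simps)
      also have "\<dots> = integral {s..t} (\<lambda>x. f' x * (g t - g x)) + integral {s..t} (\<lambda>x. g' x * (f s - f x))"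
        unfolding fi using int
        by (simp add: right_diff_distrib Henstock_Kurzweil_Integration.integral_diff integrable_on_mult_left)
      finally have "norm (P t - P s) \<le> norm (integral {s..t} (\<lambda>x. f' x * (g t - g x))) + norm (integral {s..t} (\<lambda>x. g' x * (f s - f x)))"
        by (simp add: norm_triangle_ineq)
      also have "\<dots> \<le> e * integral {s..t} (\<lambda>x. norm (f' x)) + e * integral {s..t} (\<lambda>x. norm (g' x))"
      proof (intro add_mono norm_integral_mult_le af' ag' continuous_intros cf' cg')
        fix x assume x: "x \<in> {s..t}"
        show "norm (g t - g x) \<le> e"
          using d2[of x t] x s t st by (auto simp: dist_norm)
        show "norm (f s - f x) \<le> e"
          using d1[of x s] x s t st by (auto simp: dist_norm)
      qed
      also have "\<dots> = e * (V t - V s)" by (simp add: Vst algebra_simps)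
      finally show "norm (P t - P s) \<le> e * (V t - V s)" .
    qed (use d in auto)
  qed
  have "f x * g x = f 0 * g 0 + integral {0..x} ?h" if "x \<in> {0..1}" for x
  proof -
    have "P 0 = f 0 * g 0" by (simp add: P_def)
    with P[OF that] show ?thesis unfolding P_def by (metis diff_add_cancel)
  qed
  thus ?thesis using ah unfolding abs_cont_deriv_def by blast
qed

lemma abs_cont_deriv_cmult:
  assumes "abs_cont_deriv f f'"
  shows "abs_cont_deriv (\<lambda>x. c * f x) (\<lambda>x. c * f' x)"
  unfolding abs_cont_deriv_def
proof (intro conjI ballI)
  show "(\<lambda>x. c * f' x) absolutely_integrable_on {0..1}"
    by (intro set_integrable_mult_right abs_cont_derivD(1)[OF assms])
  show "c * f x = c * f 0 + integral {0..x} (\<lambda>x. c * f' x)" if "x \<in> {0..1}" for x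
    by (subst abs_cont_derivD(2)[OF assms that]) (simp add: distrib_left)
qed

lemma abs_cont_deriv_add:
  assumes f: "abs_cont_deriv f f'" and g: "abs_cont_deriv g g'"
  shows "abs_cont_deriv (\<lambda>x. f x + g x) (\<lambda>x. f' x + g' x)"
  unfolding abs_cont_deriv_def
proof (intro conjI ballI)
  show "(\<lambda>x. f' x + g' x) absolutely_integrable_on {0..1}"
    by (intro set_integral_add abs_cont_derivD(1)[OF f] abs_cont_derivD(1)[OF g])
  fix x :: real assume x: "x \<in> {0..1}"
  hence "{0..x} \<subseteq> {0..1}" by auto
  hence "integral {0..x} (\<lambda>x. f' x + g' x) = integral {0..x} f' + integral {0..x} g'"
    using abs_cont_derivD(1)[OF f] abs_cont_derivD(1)[OF g]
    by (intro Henstock_Kurzweil_Integration.integral_add absolutely_integrable_integrable)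
  thus "f x + g x = f 0 + g 0 + integral {0..x} (\<lambda>x. f' x + g' x)"
    by (subst abs_cont_derivD(2)[OF f x], subst abs_cont_derivD(2)[OF g x]) simp
qed

section \<open>Fourier modes and the Riemann--Lebesgue lemma\<close>

lemma norm_efun [simp]: "cmod (efun k x) = 1"
  by (simp add: efun_def)

lemma cnj_efun: "cnj (efun k x) = efun (- k) x"
  by (simp add: efun_def exp_cnj)

lemma efun_mult: "efun j x * efun k x = efun (j + k) x"
  by (simp add: efun_def ring_distribs flip: exp_add)

lemma efun_0 [simp]: "efun 0 x = 1"
  by (simp add: efun_def)

lemma efun_at_0 [simp]: "efun k 0 = 1"
  by (simp add: efun_def)

lemma efun_at_1 [simp]: "efun k 1 = 1"
  using exp_integer_2pi[of "of_int k"] by (simp add: efun_def mult_ac)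

lemma efun_cancel [simp]: "efun k x * efun (- k) x = 1" "efun (- k) x * efun k x = 1"
  by (simp_all add: efun_mult)

lemma continuous_on_efun [continuous_intros]: "continuous_on A (efun k)"
  unfolding efun_def by (intro continuous_intros)

lemma has_vector_derivative_efun:
  "(efun k has_vector_derivative \<i> * of_real (2 * pi * of_int k) * efun k x) (at x within A)"
proof -
  have "((\<lambda>z. exp (\<i> * of_real (2 * pi * of_int k) * z)) has_field_derivative
      \<i> * of_real (2 * pi * of_int k) * exp (\<i> * of_real (2 * pi * of_int k) * of_real x))
      (at (of_real x))"
    by (auto intro!: derivative_eq_intros)
  from has_vector_derivative_real_field[OF this, of A]
  show ?thesis unfolding efun_def by (simp add: mult_ac)
qed

lemma abs_cont_deriv_efun:
  "abs_cont_deriv (efun k) (\<lambda>x. \<i> * of_real (2 * pi * of_int k) * efun k x)"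
proof -
  have "((\<lambda>x. \<i> * of_real (2 * pi * of_int k) * efun k x) has_integral (efun k x - efun k 0)) {0..x}"
    if "x \<ge> 0" for x
    by (intro fundamental_theorem_of_calculus that has_vector_derivative_efun)
  hence "integral {0..x} (\<lambda>x. \<i> * of_real (2 * pi * of_int k) * efun k x) = efun k x - 1" if "x \<ge> 0" for x
    using that by (metis efun_at_0 integral_unique)
  moreover have "(\<lambda>x. \<i> * of_real (2 * pi * of_int k) * efun k x) absolutely_integrable_on {0..1}"
    by (intro absolutely_integrable_continuous_real continuous_intros)
  ultimately show ?thesis unfolding abs_cont_deriv_def by simp
qed

lemma has_integral_efun: "(efun k has_integral (if k = 0 then 1 else 0)) {0..1}"
proof (cases "k = 0")
  case True
  have "((\<lambda>x::real. 1::complex) has_integral 1) {0..1}"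
    using has_integral_const_real[of "1::complex" 0 1] by simp
  moreover have "efun k = (\<lambda>x. 1)" using True by (simp add: fun_eq_iff)
  ultimately show ?thesis using True by simp
next
  case False
  let ?c = "\<i> * of_real (2 * pi * of_int k) :: complex"
  have "((\<lambda>x. ?c * efun k x) has_integral (efun k 1 - efun k 0)) {0..1}"
    by (intro fundamental_theorem_of_calculus has_vector_derivative_efun) auto
  from has_integral_mult_right[OF this, of "inverse ?c"] False show ?thesis
    by (simp add: field_simps)
qed

text \<open>
  With \<open>c k\<close> the coefficients and \<open>T\<close> the conjugate of the trigonometric polynomial that they
  define, the inequality is \<open>0 \<le> \<parallel>f - cnj T\<parallel>\<^sup>2\<close>, expanded by orthonormality of the exponentials.
\<close>

lemma bessel_inequality:
  fixes f :: "real \<Rightarrow> complex"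
  assumes f: "f absolutely_integrable_on {0..1}"
    and f2: "(\<lambda>x. (cmod (f x))\<^sup>2) integrable_on {0..1}" and F: "finite F"
  shows "(\<Sum>k\<in>F. (cmod (integral {0..1} (\<lambda>x. f x * efun k x)))\<^sup>2)
           \<le> integral {0..1} (\<lambda>x. (cmod (f x))\<^sup>2)"
proof -
  define c where "c = (\<lambda>k. integral {0..1} (\<lambda>x. f x * efun k x))"
  define W where "W = (\<Sum>k\<in>F. (cmod (c k))\<^sup>2)"
  define T where "T = (\<lambda>x. \<Sum>k\<in>F. cnj (c k) * efun k x)"
  have c: "((\<lambda>x. f x * efun k x) has_integral c k) {0..1}" for k
    unfolding c_def using absolutely_integrable_mult_continuous[OF f continuous_on_efun]
    by (intro integrable_integral) (simp add: absolutely_integrable_on_def)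
  have fT: "((\<lambda>x. f x * T x) has_integral of_real W) {0..1}"
  proof -
    have "((\<lambda>x. \<Sum>k\<in>F. cnj (c k) * (f x * efun k x)) has_integral (\<Sum>k\<in>F. cnj (c k) * c k)) {0..1}"
      by (intro has_integral_sum F has_integral_mult_right c)
    moreover have "(\<Sum>k\<in>F. cnj (c k) * c k) = of_real W"
      unfolding W_def of_real_sum complex_norm_square by (simp add: mult.commute)
    ultimately show ?thesis by (simp add: T_def sum_distrib_left mult_ac)
  qed
  have eT: "((\<lambda>x. cnj (efun k x) * T x) has_integral cnj (c k)) {0..1}" if "k \<in> F" for k
  proof -
    have "((\<lambda>x. \<Sum>l\<in>F. cnj (c l) * efun (l - k) x) has_integral
        (\<Sum>l\<in>F. cnj (c l) * (if l - k = 0 then 1 else 0))) {0..1}"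
      by (intro has_integral_sum F has_integral_mult_right has_integral_efun)
    moreover have "(\<Sum>l\<in>F. cnj (c l) * (if l - k = 0 then 1 else 0)) = cnj (c k)"
      using F that by (simp add: if_distrib cong: if_cong)
    moreover have "cnj (efun k x) * T x = (\<Sum>l\<in>F. cnj (c l) * efun (l - k) x)" for x
      unfolding T_def sum_distrib_left
      by (intro sum.cong) (auto simp: cnj_efun mult.left_commute efun_mult)
    ultimately show ?thesis by simp
  qed
  have TT: "((\<lambda>x. cnj (T x) * T x) has_integral of_real W) {0..1}"
  proof -
    have "((\<lambda>x. \<Sum>k\<in>F. c k * (cnj (efun k x) * T x)) has_integral (\<Sum>k\<in>F. c k * cnj (c k))) {0..1}"
      by (intro has_integral_sum F has_integral_mult_right eT)
    moreover have "(\<Sum>k\<in>F. c k * cnj (c k)) = of_real W"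
      unfolding W_def of_real_sum complex_norm_square by simp
    moreover have "(\<Sum>k\<in>F. c k * (cnj (efun k x) * T x)) = cnj (T x) * T x" for x
      by (simp add: T_def cnj_sum sum_distrib_right mult_ac)
    ultimately show ?thesis by simp
  qed
  have "((\<lambda>x. (cmod (f x))\<^sup>2 - 2 * Re (f x * T x) + Re (cnj (T x) * T x)) has_integral
      (integral {0..1} (\<lambda>x. (cmod (f x))\<^sup>2) - 2 * W + W)) {0..1}"
    using has_integral_linear[OF fT bounded_linear_Re] has_integral_linear[OF TT bounded_linear_Re]
    by (intro has_integral_add has_integral_diff has_integral_mult_right integrable_integral f2)
       (auto simp: o_def)
  moreover have "(cmod (f x))\<^sup>2 - 2 * Re (f x * T x) + Re (cnj (T x) * T x) = (cmod (f x - cnj (T x)))\<^sup>2" for x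
    unfolding cmod_power2 by (simp add: power2_eq_square algebra_simps)
  ultimately have "((\<lambda>x. (cmod (f x - cnj (T x)))\<^sup>2) has_integral
      (integral {0..1} (\<lambda>x. (cmod (f x))\<^sup>2) - 2 * W + W)) {0..1}" by simp
  hence "0 \<le> integral {0..1} (\<lambda>x. (cmod (f x))\<^sup>2) - 2 * W + W"
    by (rule has_integral_nonneg) auto
  thus ?thesis by (simp add: W_def c_def)
qed

lemma riemann_lebesgue_bounded:
  fixes f :: "real \<Rightarrow> complex"
  assumes f: "f absolutely_integrable_on {0..1}" and s: "s \<noteq> 0"
    and bound: "\<And>x. x \<in> {0..1} \<Longrightarrow> cmod (f x) \<le> B"
  shows "(\<lambda>n. integral {0..1} (\<lambda>x. f x * efun (s * int n) x)) \<longlonglongrightarrow> 0"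
proof -
  let ?c = "\<lambda>n. (cmod (integral {0..1} (\<lambda>x. f x * efun (s * int n) x)))\<^sup>2"
  have f2: "(\<lambda>x. (cmod (f x))\<^sup>2) integrable_on {0..1}"
  proof (rule measurable_bounded_by_integrable_imp_integrable)
    have [measurable]: "f \<in> borel_measurable (lebesgue_on {0..1})"
      using f by (rule absolutely_integrable_imp_borel_measurable) auto
    show "(\<lambda>x. (cmod (f x))\<^sup>2) \<in> borel_measurable (lebesgue_on {0..1})" by measurable
    show "(\<lambda>x. B\<^sup>2) integrable_on {0..1::real}" by (rule integrable_const_ivl)
    show "norm ((cmod (f x))\<^sup>2) \<le> B\<^sup>2" if "x \<in> {0..1}" for x
      using bound[OF that] by (auto intro: power_mono)
  qed auto
  have "summable ?c"
  proof (rule bounded_imp_summable)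
    fix N
    have inj: "inj_on (\<lambda>n. s * int n) {..N}" using s by (auto simp: inj_on_def)
    have "sum ?c {..N} = (\<Sum>k\<in>(\<lambda>n. s * int n) ` {..N}. (cmod (integral {0..1} (\<lambda>x. f x * efun k x)))\<^sup>2)"
      by (simp add: sum.reindex[OF inj])
    also have "\<dots> \<le> integral {0..1} (\<lambda>x. (cmod (f x))\<^sup>2)"
      by (rule bessel_inequality[OF f f2]) auto
    finally show "sum ?c {..N} \<le> integral {0..1} (\<lambda>x. (cmod (f x))\<^sup>2)" .
  qed auto
  from summable_LIMSEQ_zero[OF this] have "(\<lambda>n. sqrt (?c n)) \<longlonglongrightarrow> sqrt 0"
    by (rule tendsto_real_sqrt)
  thus ?thesis by (simp add: tendsto_norm_zero_iff)
qed

text \<open>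
  Bessel's inequality covers bounded functions.  A general \<open>f\<close> is cut off at height \<open>m\<close>; the error
  is small in \<open>L\<^sub>1\<close> by dominated convergence, hence in every coefficient simultaneously.
\<close>

lemma riemann_lebesgue:
  fixes f :: "real \<Rightarrow> complex"
  assumes f: "f absolutely_integrable_on {0..1}" and s: "s \<noteq> 0"
  shows "(\<lambda>n. integral {0..1} (\<lambda>x. f x * efun (s * int n) x)) \<longlonglongrightarrow> 0"
proof (rule LIMSEQ_I)
  fix e :: real assume e: "e > 0"
  define g where "g = (\<lambda>m x. if cmod (f x) \<le> real m then f x else 0)"
  have [measurable]: "f \<in> borel_measurable (lebesgue_on {0..1})"
    using f by (rule absolutely_integrable_imp_borel_measurable) auto
  have nf: "(\<lambda>x. norm (f x)) integrable_on {0..1}" using f by (simp add: absolutely_integrable_on_def)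
  have ag: "g m absolutely_integrable_on {0..1}" for m
  proof (rule measurable_bounded_by_integrable_imp_absolutely_integrable[OF _ _ nf])
    show "g m \<in> borel_measurable (lebesgue_on {0..1})" unfolding g_def by measurable
  qed (auto simp: g_def)
  have ad: "(\<lambda>x. f x - g m x) absolutely_integrable_on {0..1}" for m
    using f ag by (intro set_integral_diff)
  have "(\<lambda>m. integral {0..1} (\<lambda>x. norm (f x - g m x))) \<longlonglongrightarrow> integral {0..1::real} (\<lambda>x. 0)"
  proof (rule dominated_convergence(2)[where h = "\<lambda>x. norm (f x)" and g = "\<lambda>x. 0"
        and f = "\<lambda>m x. norm (f x - g m x)"])
    show "(\<lambda>x. norm (f x - g m x)) integrable_on {0..1}" for m
      using ad by (simp add: absolutely_integrable_on_def)
    show "(\<lambda>m. norm (f x - g m x)) \<longlonglongrightarrow> 0" for x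
    proof (rule tendsto_eventually)
      obtain m0 where "cmod (f x) \<le> real m0" using real_arch_simple by blast
      thus "\<forall>\<^sub>F m in sequentially. norm (f x - g m x) = 0"
        by (intro eventually_sequentiallyI[of m0]) (auto simp: g_def)
    qed
  qed (use nf in \<open>auto simp: g_def\<close>)
  from order_tendstoD(2)[OF this, of "e / 2"] e
  have "\<forall>\<^sub>F m in sequentially. integral {0..1} (\<lambda>x. norm (f x - g m x)) < e / 2" by simp
  from eventually_happens'[OF sequentially_bot this]
  obtain m where m: "integral {0..1} (\<lambda>x. norm (f x - g m x)) < e / 2" ..
  have "(\<lambda>n. integral {0..1} (\<lambda>x. g m x * efun (s * int n) x)) \<longlonglongrightarrow> 0"
    by (rule riemann_lebesgue_bounded[OF ag s, of _ m]) (auto simp: g_def)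
  then obtain N where N: "\<And>n. n \<ge> N \<Longrightarrow> norm (integral {0..1} (\<lambda>x. g m x * efun (s * int n) x)) < e / 2"
    using LIMSEQ_D[of _ 0 "e / 2"] e by fastforce
  show "\<exists>N. \<forall>n\<ge>N. norm (integral {0..1} (\<lambda>x. f x * efun (s * int n) x) - 0) < e"
  proof (intro exI[of _ N] allI impI)
    fix n assume n: "n \<ge> N"
    let ?e = "efun (s * int n)"
    have int: "(\<lambda>x. (f x - g m x) * ?e x) integrable_on {0..1}" "(\<lambda>x. g m x * ?e x) integrable_on {0..1}"
      using absolutely_integrable_mult_continuous[OF ad continuous_on_efun]
        absolutely_integrable_mult_continuous[OF ag continuous_on_efun]
      by (simp_all only: absolutely_integrable_on_def)
    have "integral {0..1} (\<lambda>x. f x * ?e x) = integral {0..1} (\<lambda>x. (f x - g m x) * ?e x + g m x * ?e x)"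
      by (simp add: left_diff_distrib)
    also have "\<dots> = integral {0..1} (\<lambda>x. (f x - g m x) * ?e x) + integral {0..1} (\<lambda>x. g m x * ?e x)"
      by (rule Henstock_Kurzweil_Integration.integral_add[OF int])
    also have "norm \<dots> \<le> norm (integral {0..1} (\<lambda>x. (f x - g m x) * ?e x)) + norm (integral {0..1} (\<lambda>x. g m x * ?e x))"
      by (rule norm_triangle_ineq)
    also have "norm (integral {0..1} (\<lambda>x. (f x - g m x) * ?e x)) \<le> 1 * integral {0..1} (\<lambda>x. norm (f x - g m x))"
      by (rule norm_integral_mult_le[OF ad continuous_on_efun]) auto
    finally show "norm (integral {0..1} (\<lambda>x. f x * ?e x) - 0) < e"
      using m N[OF n] by simp
  qed
qed

lemma riemann_lebesgue_Icc:
  fixes f :: "real \<Rightarrow> complex"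
  assumes f: "f absolutely_integrable_on {0..1}" and s: "s \<noteq> 0" and x: "x \<in> {0..1}"
  shows "(\<lambda>n. integral {0..x} (\<lambda>t. f t * efun (s * int n) t)) \<longlonglongrightarrow> 0"
proof -
  have sub: "{0..x} \<subseteq> {0..1}" using x by auto
  let ?g = "\<lambda>t. if t \<in> {0..x} then f t else 0"
  have "?g absolutely_integrable_on {0..1}"
  proof -
    have "f absolutely_integrable_on {0..x}"
      using absolutely_integrable_on_subinterval[OF f sub] .
    hence "?g absolutely_integrable_on {0..x}"
      by (rule absolutely_integrable_spike[where S = "{}"]) auto
    thus ?thesis 
    proof (rule absolutely_integrable_spike_set)
      have "{t \<in> {0..x} - {0..1}. ?g t \<noteq> 0} = {}" "{t \<in> {0..1} - {0..x}. ?g t \<noteq> 0} = {}"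
        using sub by auto
      thus "negligible {t \<in> {0..x} - {0..1}. ?g t \<noteq> 0}" "negligible {t \<in> {0..1} - {0..x}. ?g t \<noteq> 0}"
        by (simp_all only: negligible_empty)
    qed
  qed
  from riemann_lebesgue[OF this s]
  have "(\<lambda>n. integral {0..1} (\<lambda>t. ?g t * efun (s * int n) t)) \<longlonglongrightarrow> 0" .
  moreover have "integral {0..1} (\<lambda>t. ?g t * efun (s * int n) t) = integral {0..x} (\<lambda>t. f t * efun (s * int n) t)" for n
  proof -
    have "integral {0..1} (\<lambda>t. ?g t * efun (s * int n) t) = 
          integral {0..1} (\<lambda>t. if t \<in> {0..x} then f t * efun (s * int n) t else 0)"
      by (rule arg_cong[of _ _ "integral _"]) auto
    also have "\<dots> = integral ({0..1} \<inter> {0..x}) (\<lambda>t. f t * efun (s * int n) t)"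
      by (subst integral_restrict_Int) (simp only: Int_commute)
    also have "{0..1} \<inter> {0..x} = {0..x}" using sub by blast
    finally show ?thesis .
  qed
  ultimately show ?thesis by simp
qed

lemma ip01_efun: "ip01 f (efun k) = integral {0..1} (\<lambda>x. f x * efun (- k) x)"
  by (simp add: ip01_def cnj_efun)

lemma absolutely_integrable_of_real:
  fixes f :: "real \<Rightarrow> real"
  assumes "f absolutely_integrable_on S"
  shows "(\<lambda>x. complex_of_real (f x)) absolutely_integrable_on S"
  using absolutely_integrable_linear[OF assms bounded_linear_of_real] by (simp add: o_def)

section \<open>Oscillating primitives of the potential\<close>

text \<open>
  The primitives \<open>Q\<^sub>k\<close> of \<open>q e\<^sub>k\<close> that vanish at \<open>0\<close>.
\<close>

definition qint :: "(real \<Rightarrow> real) \<Rightarrow> int \<Rightarrow> real \<Rightarrow> complex" where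
  "qint q k x = integral {0..x} (\<lambda>t. complex_of_real (q t) * efun k t)"

text \<open>
  A common bound, tending to \<open>0\<close>, for the oscillating double integrals of \<open>q(x) q(t)\<close> over \<open>t < x\<close>
  that occur for the mode number \<open>n\<close>.
\<close>

definition osc :: "(real \<Rightarrow> real) \<Rightarrow> nat \<Rightarrow> real" where
  "osc q n = integral {0..1} (\<lambda>x. \<bar>q x\<bar> * cmod (qint q (2 * int n) x))"

lemma abs_cont_deriv_qint:
  assumes "q absolutely_integrable_on {0..1}"
  shows "abs_cont_deriv (qint q k) (\<lambda>x. complex_of_real (q x) * efun k x)"
  using absolutely_integrable_mult_continuous[OF absolutely_integrable_of_real[OF assms] continuous_on_efun]
  by (simp add: abs_cont_deriv_def qint_def)

lemma cmod_qint_minus: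
  "cmod (qint q (- k) x) = cmod (qint q k x)"
proof -
  have "qint q (- k) x = cnj (qint q k x)"
    unfolding qint_def integral_cnj by (simp add: cnj_efun)
  thus ?thesis by simp
qed

lemma cmod_qint_le:
  assumes "q absolutely_integrable_on {0..1}" "x \<in> {0..1}"
  shows "cmod (qint q k x) \<le> integral {0..1} (\<lambda>x. \<bar>q x\<bar>)"
proof -
  have sub: "{0..x} \<subseteq> {0..1}" using assms by auto
  note ai = absolutely_integrable_of_real[OF assms(1)]
  have "cmod (qint q k x) \<le> 1 * integral {0..x} (\<lambda>x. norm (complex_of_real (q x)))"
    unfolding qint_def
    by (rule norm_integral_mult_le[OF absolutely_integrable_on_subinterval[OF ai sub] continuous_on_efun]) simp
  also have "\<dots> \<le> integral {0..1} (\<lambda>x. \<bar>q x\<bar>)"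
    using absolutely_integrable_integrable(2)[OF assms(1) sub] absolutely_integrable_integrable(2)[OF assms(1) subset_refl] sub
    by (simp add: integral_subset_le)
  finally show ?thesis .
qed

text \<open>
  For each fixed \<open>x\<close> the primitive tends to \<open>0\<close> by the Riemann--Lebesgue lemma on \<open>[0,x]\<close>, and it is
  bounded by \<open>\<parallel>q\<parallel>\<^sub>1\<close>, so dominated convergence applies to the outer integral.
\<close>

lemma osc_tendsto_0:
  assumes "q absolutely_integrable_on {0..1}"
  shows "osc q \<longlonglongrightarrow> 0"
proof -
  let ?L = "integral {0..1} (\<lambda>x. \<bar>q x\<bar>)"
  note ai = absolutely_integrable_of_real[OF assms(1)]
  have "(\<lambda>n. integral {0..1} (\<lambda>x. \<bar>q x\<bar> * cmod (qint q (2 * int n) x))) \<longlonglongrightarrow> integral {0..1::real} (\<lambda>x. 0)"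
  proof (rule dominated_convergence(2)[where h = "\<lambda>x. \<bar>q x\<bar> * ?L"])
    fix n
    have "(\<lambda>x. complex_of_real (q x) * qint q (2 * int n) x) absolutely_integrable_on {0..1}"
      by (intro absolutely_integrable_mult_continuous ai abs_cont_deriv_continuous[OF abs_cont_deriv_qint] assms)
    thus "(\<lambda>x. \<bar>q x\<bar> * cmod (qint q (2 * int n) x)) integrable_on {0..1}"
      by (simp add: absolutely_integrable_on_def norm_mult)
  next
    show "(\<lambda>x. \<bar>q x\<bar> * ?L) integrable_on {0..1}"
      using assms by (intro integrable_on_mult_left) (auto simp: absolutely_integrable_on_def)
  next
    fix n and x :: real assume "x \<in> {0..1}"
    thus "norm (\<bar>q x\<bar> * cmod (qint q (2 * int n) x)) \<le> \<bar>q x\<bar> * ?L"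
      using cmod_qint_le[OF assms] by (simp add: abs_mult mult_left_mono)
  next
    fix x :: real assume "x \<in> {0..1}"
    from riemann_lebesgue_Icc[OF ai _ this, of 2]
    have "(\<lambda>n. qint q (2 * int n) x) \<longlonglongrightarrow> 0" by (simp add: qint_def)
    thus "(\<lambda>n. \<bar>q x\<bar> * cmod (qint q (2 * int n) x)) \<longlonglongrightarrow> 0"
      by (intro tendsto_mult_right_zero tendsto_norm_zero)
  qed
  thus ?thesis by (simp add: osc_def[abs_def])
qed

lemma qcoeff_tendsto_0:
  assumes "q absolutely_integrable_on {0..1}"
  shows "(\<lambda>n. cmod (qcoeff q (2 * int n))) \<longlonglongrightarrow> 0"
  using riemann_lebesgue[OF absolutely_integrable_of_real[OF assms], of "-2"]
  by (simp add: qcoeff_def ip01_efun tendsto_norm_zero)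

section \<open>Eigenfunctions of the periodic operator\<close>

lemma eigenspace_cases:
  assumes "y \<in> eigenspace q mu"
  obtains y1 y2 where "abs_cont_deriv y y1" "abs_cont_deriv y1 y2" "y 1 = y 0" "y1 1 = y1 0"
    "AE x in lebesgue_on {0..1}. y2 x = complex_of_real (q x - mu) * y x"
proof -
  from assms obtain y1 y2 where y: "abs_cont_deriv y y1" "abs_cont_deriv y1 y2" "y 1 = y 0" "y1 1 = y1 0"
    "AE x in lebesgue_on {0..1}. of_real mu * y x = - y2 x + complex_of_real (q x) * y x"
    unfolding eigenspace_def periodic_op_def by blast
  from y(5) have "AE x in lebesgue_on {0..1}. y2 x = complex_of_real (q x - mu) * y x"
    by (rule eventually_mono) (simp add: algebra_simps)
  with y show ?thesis using that by blast
qed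

text \<open>
  The Wronskian \<open>y' z - y z'\<close> has derivative \<open>(nu - mu) y z\<close> and takes equal values at \<open>0\<close> and \<open>1\<close>.
  The integral carries no conjugation; for real eigenfunctions it is the inner product.
\<close>

lemma eigenfunctions_orthogonal:
  assumes y: "y \<in> eigenspace q mu" and z: "z \<in> eigenspace q nu" and neq: "mu \<noteq> nu"
  shows "integral {0..1} (\<lambda>x. y x * z x) = 0"
proof -
  obtain y1 y2 where y': "abs_cont_deriv y y1" "abs_cont_deriv y1 y2" "y 1 = y 0" "y1 1 = y1 0"
    "AE x in lebesgue_on {0..1}. y2 x = complex_of_real (q x - mu) * y x"
    using y by (rule eigenspace_cases)
  obtain z1 z2 where z': "abs_cont_deriv z z1" "abs_cont_deriv z1 z2" "z 1 = z 0" "z1 1 = z1 0"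
    "AE x in lebesgue_on {0..1}. z2 x = complex_of_real (q x - nu) * z x"
    using z by (rule eigenspace_cases)
  let ?W = "\<lambda>x. y1 x * z x + (-1) * (z1 x * y x)"
  let ?d = "\<lambda>x. (y2 x * z x + z1 x * y1 x) + (-1) * (z2 x * y x + y1 x * z1 x)"
  have "abs_cont_deriv ?W ?d"
    by (intro abs_cont_deriv_add abs_cont_deriv_cmult abs_cont_deriv_mult y' z')
  moreover have "AE x in lebesgue_on {0..1}. complex_of_real (nu - mu) * (y x * z x) = ?d x"
    using y'(5) z'(5)
  proof eventually_elim
    case (elim x)
    show ?case unfolding elim by (simp add: algebra_simps)
  qed
  ultimately have "abs_cont_deriv ?W (\<lambda>x. complex_of_real (nu - mu) * (y x * z x))"
    by (rule abs_cont_deriv_cong_AE)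
  from abs_cont_derivD(2)[OF this, of 1]
  have "complex_of_real (nu - mu) * integral {0..1} (\<lambda>x. y x * z x) = 0"
    using y'(3,4) z'(3,4) by simp
  thus ?thesis using neq by (auto simp del: of_real_diff)
qed

section \<open>An eigenfunction near a Fourier mode\<close>

text \<open>
  An eigenfunction \<open>y\<close> is compared with the modes \<open>e\<^sub>n\<close> and \<open>e\<^sub>-\<^sub>n\<close>.  Below, \<open>delta\<close> is the shift of its
  eigenvalue from \<open>omega\<^sup>2\<close>, \<open>L\<close> is the \<open>L\<^sub>1\<close>-norm of \<open>q\<close>, \<open>h\<close> is the right-hand side of
  \<open>y'' + omega\<^sup>2 y = h\<close>, and \<open>K\<close> bounds the \<open>L\<^sub>1\<close>-norm of \<open>h\<close>.  The correction \<open>R\<close> is the Duhamel integral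
  \<open>\<integral>\<^sub>0\<^sup>x sin (omega (x - t)) h t dt\<close>, split into exponentials so that only the primitives \<open>H k\<close> of
  \<open>h e\<^sub>k\<close> appear.
\<close>

locale eigenfunction_mode =
  fixes q :: "real \<Rightarrow> real" and y :: "real \<Rightarrow> complex" and mu :: real and n :: nat and M :: real
  assumes q_ai: "q absolutely_integrable_on {0..1}"
    and q_mean: "integral {0..1} q = 0"
    and eigen: "y \<in> eigenspace q mu"
    and n_pos: "n > 0"
    and bound: "\<And>x. x \<in> {0..1} \<Longrightarrow> cmod (y x) \<le> M"
begin

definition omega :: real where "omega = 2 * pi * real n"
definition delta :: real where "delta = mu - omega\<^sup>2"
definition L :: real where "L = integral {0..1} (\<lambda>x. \<bar>q x\<bar>)"
definition K :: real where "K = (L + \<bar>delta\<bar>) * M"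
definition h :: "real \<Rightarrow> complex" where "h x = complex_of_real (q x - delta) * y x"
definition H :: "int \<Rightarrow> real \<Rightarrow> complex" where "H k x = integral {0..x} (\<lambda>t. h t * efun k t)"
definition R :: "real \<Rightarrow> complex" where
  "R x = (H (- int n) x * efun (int n) x - H (int n) x * efun (- int n) x) / (2 * \<i>)"
abbreviation "u \<equiv> ip01 y (efun (int n))"
abbreviation "v \<equiv> ip01 y (efun (- int n))"

lemma omega_pos: "omega > 0"
  using n_pos by (simp add: omega_def)

lemma M_nonneg: "M \<ge> 0"
  using bound[of 0] norm_ge_zero[of "y 0"] by (simp del: norm_ge_zero)

lemma L_nonneg: "L \<ge> 0"
  unfolding L_def using absolutely_integrable_integrable(2)[OF q_ai subset_refl]
  by (intro Henstock_Kurzweil_Integration.integral_nonneg) auto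

lemma K_nonneg: "K \<ge> 0"
  unfolding K_def using M_nonneg L_nonneg by auto

lemmas qc_ai = absolutely_integrable_of_real[OF q_ai]

lemma y_continuous: "continuous_on {0..1} y"
  using eigen by (elim eigenspace_cases) (rule abs_cont_deriv_continuous)

lemma h_ai: "h absolutely_integrable_on {0..1}"
proof -
  have "(\<lambda>x. complex_of_real (q x) * y x - of_real delta * y x) absolutely_integrable_on {0..1}"
    by (intro set_integral_diff absolutely_integrable_mult_continuous qc_ai y_continuous
         absolutely_integrable_continuous_real continuous_intros)
  thus ?thesis by (simp add: h_def[abs_def] algebra_simps)
qed

lemma abs_cont_deriv_H: "abs_cont_deriv (H k) (\<lambda>x. h x * efun k x)"
  using absolutely_integrable_mult_continuous[OF h_ai continuous_on_efun]
  by (simp add: abs_cont_deriv_def H_def)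

lemma primitive_bound:
  assumes g: "g absolutely_integrable_on {0..1}"
    and le: "\<And>x. x \<in> {0..1} \<Longrightarrow> cmod (g x) \<le> \<bar>q x\<bar> * a + b"
    and x: "x \<in> {0..1}"
  shows "cmod (integral {0..x} (\<lambda>t. g t * efun k t)) \<le> L * a + b"
proof -
  have sub: "{0..x} \<subseteq> {0..1}" using x by auto
  have "cmod (integral {0..x} (\<lambda>t. g t * efun k t)) \<le> 1 * integral {0..x} (\<lambda>x. norm (g x))"
    by (rule norm_integral_mult_le[OF absolutely_integrable_on_subinterval[OF g sub] continuous_on_efun]) simp
  also have "\<dots> \<le> integral {0..1} (\<lambda>x. norm (g x))"
    using absolutely_integrable_integrable(2)[OF g sub] absolutely_integrable_integrable(2)[OF g subset_refl] sub
    by (simp add: integral_subset_le)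
  also have "\<dots> \<le> L * a + b"
  proof (rule has_integral_le)
    show "((\<lambda>x. norm (g x)) has_integral integral {0..1} (\<lambda>x. norm (g x))) {0..1}"
      using absolutely_integrable_integrable(2)[OF g subset_refl] by (rule integrable_integral)
    show "((\<lambda>x. \<bar>q x\<bar> * a + b) has_integral (L * a + b)) {0..1}"
      using absolutely_integrable_integrable(2)[OF q_ai subset_refl]
        has_integral_const_real[of b 0 1] unfolding L_def
      by (intro has_integral_add has_integral_mult_left integrable_integral) auto
  qed (rule le)
  finally show ?thesis .
qed

lemma H_bound:
  assumes x: "x \<in> {0..1}"
  shows "cmod (H k x) \<le> K"
proof -
  have "cmod (H k x) \<le> L * M + \<bar>delta\<bar> * M"
    unfolding H_def
  proof (rule primitive_bound[OF h_ai _ x])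
    fix x :: real assume x: "x \<in> {0..1}"
    have "cmod (h x) = \<bar>q x - delta\<bar> * cmod (y x)" unfolding h_def by (simp only: norm_mult norm_of_real)
    also have "\<dots> \<le> (\<bar>q x\<bar> + \<bar>delta\<bar>) * M"
      using bound[OF x] by (intro mult_mono) auto
    finally show "cmod (h x) \<le> \<bar>q x\<bar> * M + \<bar>delta\<bar> * M" by (simp add: algebra_simps)
  qed
  thus ?thesis by (simp add: K_def algebra_simps)
qed

lemma R_bound:
  assumes x: "x \<in> {0..1}"
  shows "cmod (R x) \<le> K"
proof -
  have "cmod (R x) \<le> (cmod (H (- int n) x * efun (int n) x) + cmod (H (int n) x * efun (- int n) x)) / 2"
    unfolding R_def norm_divide by (simp add: norm_mult norm_triangle_ineq4 divide_right_mono del: norm_mult)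
  also have "\<dots> \<le> K" using H_bound[OF x, of "int n"] H_bound[OF x, of "- int n"]
    by (simp add: norm_mult)
  finally show ?thesis .
qed

lemma R_continuous: "continuous_on {0..1} R"
proof -
  have "continuous_on {0..1} (H k)" for k
    using abs_cont_deriv_H by (rule abs_cont_deriv_continuous)
  thus ?thesis unfolding R_def[abs_def] by (intro continuous_intros) auto
qed

text \<open>
  The functions \<open>z\<^sub>k = (y' + 2\<pi>ik y) e\<^sub>-\<^sub>k\<close> for \<open>k = n\<close> and \<open>k = - n\<close> have derivative \<open>h e\<^sub>-\<^sub>k\<close>, hence equal
  \<open>z\<^sub>k(0) + H (- k)\<close>, and \<open>y\<close> is a linear combination of \<open>z\<^sub>n e\<^sub>n\<close> and \<open>z\<^sub>-\<^sub>n e\<^sub>-\<^sub>n\<close>.  The periodic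
  boundary conditions say that \<open>z\<^sub>n\<close> returns to its initial value, so \<open>h\<close> is orthogonal to the mode.
\<close>

lemma variation_of_constants:
  obtains A B where "\<And>x. x \<in> {0..1} \<Longrightarrow> y x = A * efun (int n) x + B * efun (- int n) x + R x / omega"
    and "H (- int n) 1 = 0"
proof -
  obtain y1 y2 where y: "abs_cont_deriv y y1" "abs_cont_deriv y1 y2" "y 1 = y 0" "y1 1 = y1 0"
    "AE x in lebesgue_on {0..1}. y2 x = complex_of_real (q x - mu) * y x"
    using eigen by (rule eigenspace_cases)
  define z where "z = (\<lambda>k x. (y1 x + \<i> * of_real (2 * pi * of_int k) * y x) * efun (- k) x)"
  have z: "z k x = z k 0 + H (- k) x" if k: "k = int n \<or> k = - int n" and x: "x \<in> {0..1}" for k x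
  proof -
    let ?c = "\<i> * of_real (2 * pi * of_int k) :: complex"
    let ?d = "\<lambda>x. (y2 x + ?c * y1 x) * efun (- k) x + \<i> * of_real (2 * pi * of_int (- k)) * efun (- k) x * (y1 x + ?c * y x)"
    have 1: "abs_cont_deriv (\<lambda>x. y1 x + ?c * y x) (\<lambda>x. y2 x + ?c * y1 x)"
      by (rule abs_cont_deriv_add[OF y(2) abs_cont_deriv_cmult[OF y(1)]])
    have "abs_cont_deriv (z k) ?d"
      unfolding z_def by (rule abs_cont_deriv_mult[OF 1 abs_cont_deriv_efun])
    moreover have "AE x in lebesgue_on {0..1}. h x * efun (- k) x = ?d x"
      using y(5)
    proof (rule eventually_mono)
      fix x assume y2: "y2 x = complex_of_real (q x - mu) * y x"
      have c2: "?c * ?c = - of_real (omega\<^sup>2)"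
        using k by (auto simp: omega_def power2_eq_square)
      have "?d x = (y2 x - ?c * ?c * y x) * efun (- k) x"
        by (simp add: algebra_simps)
      also have "\<dots> = h x * efun (- k) x"
        unfolding c2 y2 h_def delta_def by (simp add: algebra_simps)
      finally show "h x * efun (- k) x = ?d x" ..
    qed
    ultimately have "abs_cont_deriv (z k) (\<lambda>x. h x * efun (- k) x)"
      by (rule abs_cont_deriv_cong_AE)
    from abs_cont_derivD(2)[OF this x] show ?thesis by (simp add: H_def)
  qed
  have z1: "z k 1 = z k 0" for k using y(3,4) by (simp add: z_def)
  define A where "A = z (int n) 0 / (2 * \<i> * omega)"
  define B where "B = - z (- int n) 0 / (2 * \<i> * omega)"
  have o: "complex_of_real omega \<noteq> 0" using omega_pos by simp
  show ?thesis
  proof (rule that)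
    fix x :: real assume x: "x \<in> {0..1}"
    have "z (int n) x * efun (int n) x = y1 x + \<i> * of_real omega * y x"
      by (simp add: z_def omega_def mult.assoc)
    moreover have "z (- int n) x * efun (- int n) x = y1 x - \<i> * of_real omega * y x"
      by (simp add: z_def omega_def mult.assoc)
    ultimately have "y x = (z (int n) x * efun (int n) x - z (- int n) x * efun (- int n) x) / (2 * \<i> * omega)"
      using o by (simp add: field_simps)
    also have "\<dots> = A * efun (int n) x + B * efun (- int n) x + R x / omega"
      using z[OF _ x, of "int n"] z[OF _ x, of "- int n"] o
      by (simp add: A_def B_def R_def field_simps)
    finally show "y x = A * efun (int n) x + B * efun (- int n) x + R x / omega" .
  qed (use z[of "int n" 1] z1 in auto)
qed

lemma n_neq: "- int n + - int n \<noteq> 0" "int n + int n \<noteq> 0"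
  using n_pos by auto

lemma u_bound: "cmod (ip01 y (efun k)) \<le> M"
proof -
  have "cmod (integral {0..1} (\<lambda>x. y x * efun (- k) x)) \<le> M * (1 - 0)"
    by (rule integral_bound) (auto intro!: continuous_intros y_continuous bound simp: norm_mult)
  thus ?thesis by (simp add: ip01_efun)
qed

text \<open>
  Pairing the expansion of \<open>y\<close> with a mode shows that \<open>A\<close> and \<open>B\<close> are the Fourier coefficients of \<open>y\<close>
  up to \<open>K / omega\<close>.
\<close>

lemma mode_expansion:
  obtains A B where "\<And>x. x \<in> {0..1} \<Longrightarrow> y x = A * efun (int n) x + B * efun (- int n) x + R x / omega"
    and "cmod (u - A) \<le> K / omega" "cmod (v - B) \<le> K / omega"
proof -
  obtain A B where e: "\<And>x. x \<in> {0..1} \<Longrightarrow> y x = A * efun (int n) x + B * efun (- int n) x + R x / omega"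
    by (rule variation_of_constants) blast
  let ?r = "\<lambda>k. integral {0..1} (\<lambda>x. R x * efun k x)"
  have r: "((\<lambda>x. R x * efun k x) has_integral ?r k) {0..1}" for k
    by (intro integrable_integral integrable_continuous_real continuous_intros R_continuous)
  have rb: "cmod (?r k / omega) \<le> K / omega" for k
  proof -
    have "cmod (?r k) \<le> K * (1 - 0)"
      by (rule integral_bound) (auto intro!: continuous_intros R_continuous R_bound simp: norm_mult)
    thus ?thesis using omega_pos by (simp add: norm_divide divide_right_mono)
  qed
  have int: "((\<lambda>x. y x * efun k x) has_integral
     A * (if int n + k = 0 then 1 else 0) + B * (if - int n + k = 0 then 1 else 0) + ?r k / omega) {0..1}" for k
  proof (rule has_integral_eq)
    show "((\<lambda>x. A * efun (int n + k) x + B * efun (- int n + k) x + R x * efun k x / omega) has_integral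
       A * (if int n + k = 0 then 1 else 0) + B * (if - int n + k = 0 then 1 else 0) + ?r k / omega) {0..1}"
      by (intro has_integral_add has_integral_mult_right has_integral_divide has_integral_efun r)
    fix x :: real assume "x \<in> {0..1}"
    thus "A * efun (int n + k) x + B * efun (- int n + k) x + R x * efun k x / omega = y x * efun k x"
      by (simp only: e distrib_right mult.assoc efun_mult times_divide_eq_left)
  qed
  have "u = A + ?r (- int n) / omega"
    using integral_unique[OF int[of "- int n"]] n_neq by (simp add: ip01_efun)
  moreover have "v = B + ?r (int n) / omega"
    using integral_unique[OF int[of "int n"]] n_neq by (simp add: ip01_efun)
  ultimately have "cmod (u - A) \<le> K / omega" "cmod (v - B) \<le> K / omega"
    using rb[of "- int n"] rb[of "int n"] by simp_all
  with e show ?thesis by (rule that)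
qed

lemma two_mode_approximation:
  assumes x: "x \<in> {0..1}"
  shows "cmod (y x - u * efun (int n) x - v * efun (- int n) x) \<le> 3 * K / omega"
proof -
  obtain A B where e: "\<And>x. x \<in> {0..1} \<Longrightarrow> y x = A * efun (int n) x + B * efun (- int n) x + R x / omega"
    and A: "cmod (u - A) \<le> K / omega" and B: "cmod (v - B) \<le> K / omega"
    by (rule mode_expansion) blast
  have "y x - u * efun (int n) x - v * efun (- int n) x =
     R x / omega - (u - A) * efun (int n) x - (v - B) * efun (- int n) x"
    using e[OF x] by (simp add: algebra_simps)
  also have "cmod \<dots> \<le> cmod (R x / omega) + cmod ((u - A) * efun (int n) x) + cmod ((v - B) * efun (- int n) x)"
    by (meson add_right_mono norm_triangle_ineq4 order_trans)
  also have "\<dots> \<le> K / omega + K / omega + K / omega"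
    using R_bound[OF x] A B omega_pos by (intro add_mono) (auto simp: norm_mult norm_divide divide_right_mono)
  finally show ?thesis by simp
qed

lemma q_has_integral:
  assumes "continuous_on {0..1} f"
  shows "((\<lambda>x. complex_of_real (q x) * f x) has_integral integral {0..1} (\<lambda>x. complex_of_real (q x) * f x)) {0..1}"
  by (intro integrable_integral absolutely_integrable_integrable(1)[OF _ subset_refl]
      absolutely_integrable_mult_continuous qc_ai assms)

lemma q_integral_bound:
  assumes "continuous_on {0..1} f" "\<And>x. x \<in> {0..1} \<Longrightarrow> cmod (f x) \<le> C"
  shows "cmod (integral {0..1} (\<lambda>x. complex_of_real (q x) * f x)) \<le> C * L"
  using norm_integral_mult_le[OF qc_ai assms] by (simp add: L_def)

lemma q_mean_complex: "((\<lambda>x. complex_of_real (q x)) has_integral 0) {0..1}"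
proof -
  have "(q has_integral 0) {0..1}"
    using absolutely_integrable_integrable(1)[OF q_ai subset_refl] q_mean by (metis integrable_integral)
  from has_integral_linear[OF this bounded_linear_of_real] show ?thesis by (simp add: o_def)
qed

text \<open>
  This restates that \<open>h\<close> is orthogonal to \<open>e\<^sub>n\<close>, with \<open>h = q y - delta y\<close>.
\<close>

lemma delta_u: "delta * u = integral {0..1} (\<lambda>x. complex_of_real (q x) * (y x * efun (- int n) x))"
proof -
  have "H (- int n) 1 = 0" by (rule variation_of_constants) blast
  hence "0 = integral {0..1} (\<lambda>x. h x * efun (- int n) x)" by (simp add: H_def)
  also have "\<dots> = integral {0..1} (\<lambda>x. complex_of_real (q x) * (y x * efun (- int n) x) - delta * (y x * efun (- int n) x))"
    by (simp add: h_def algebra_simps)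
  also have "\<dots> = integral {0..1} (\<lambda>x. complex_of_real (q x) * (y x * efun (- int n) x)) - delta * u"
  proof (rule integral_unique, rule has_integral_diff)
    show "((\<lambda>x. complex_of_real (q x) * (y x * efun (- int n) x)) has_integral
       integral {0..1} (\<lambda>x. complex_of_real (q x) * (y x * efun (- int n) x))) {0..1}"
      by (intro q_has_integral continuous_intros y_continuous)
    show "((\<lambda>x. delta * (y x * efun (- int n) x)) has_integral delta * u) {0..1}"
      unfolding ip01_efun
      by (intro has_integral_mult_right integrable_integral integrable_continuous_real continuous_intros y_continuous)
  qed
  finally show ?thesis by simp
qed

text \<open>
  Any splitting of \<open>y\<close> into the two modes and a remainder exhibits the coupling coefficient
  \<open>q\<^sub>2\<^sub>n\<close>; the mode \<open>e\<^sub>n\<close> itself contributes nothing because \<open>q\<close> has mean zero.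
\<close>

lemma delta_u_expansion:
  assumes e: "\<And>x. x \<in> {0..1} \<Longrightarrow> y x = a * efun (int n) x + b * efun (- int n) x + r x"
    and r: "continuous_on {0..1} r"
  shows "delta * u = b * qcoeff q (2 * int n) + integral {0..1} (\<lambda>x. complex_of_real (q x) * (r x * efun (- int n) x))"
proof -
  have "((\<lambda>x. a * complex_of_real (q x) + b * (complex_of_real (q x) * efun (- (2 * int n)) x)
      + complex_of_real (q x) * (r x * efun (- int n) x)) has_integral
     a * 0 + b * qcoeff q (2 * int n) + integral {0..1} (\<lambda>x. complex_of_real (q x) * (r x * efun (- int n) x))) {0..1}"
    unfolding qcoeff_def ip01_efun
    by (intro has_integral_add has_integral_mult_right q_mean_complex q_has_integral continuous_intros r)
  moreover have "a * complex_of_real (q x) + b * (complex_of_real (q x) * efun (- (2 * int n)) x)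
      + complex_of_real (q x) * (r x * efun (- int n) x) = complex_of_real (q x) * (y x * efun (- int n) x)"
    if "x \<in> {0..1}" for x
    unfolding e[OF that] by (simp add: distrib_right distrib_left mult.assoc efun_mult mult.left_commute)
  ultimately have "((\<lambda>x. complex_of_real (q x) * (y x * efun (- int n) x)) has_integral
     a * 0 + b * qcoeff q (2 * int n) + integral {0..1} (\<lambda>x. complex_of_real (q x) * (r x * efun (- int n) x))) {0..1}"
    by (rule has_integral_eq[rotated])
  from integral_unique[OF this] show ?thesis by (simp add: delta_u)
qed

text \<open>
  For the exact Fourier coefficients the remainder is \<open>O(K / omega)\<close> uniformly.  This is too weak
  for \<open>o(1/n)\<close>, but it is what forces \<open>delta\<close> to tend to \<open>0\<close>.
\<close>

lemma coupling_coarse: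
  "cmod (delta * u - v * qcoeff q (2 * int n)) \<le> 3 * K / omega * L"
proof -
  let ?r = "\<lambda>x. y x - u * efun (int n) x - v * efun (- int n) x"
  have c: "continuous_on {0..1} ?r" by (intro continuous_intros y_continuous)
  have "delta * u = v * qcoeff q (2 * int n) + integral {0..1} (\<lambda>x. complex_of_real (q x) * (?r x * efun (- int n) x))"
    by (rule delta_u_expansion[OF _ c, where a = u]) simp
  moreover have "cmod (integral {0..1} (\<lambda>x. complex_of_real (q x) * (?r x * efun (- int n) x))) \<le> 3 * K / omega * L"
    by (rule q_integral_bound) (auto intro!: continuous_intros y_continuous two_mode_approximation simp: norm_mult)
  ultimately show ?thesis by simp
qed

text \<open>
  In \<open>H k\<close>, the function \<open>h\<close> may be replaced by \<open>q\<close> times the two modes: the difference is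
  \<open>q R / omega - delta y\<close>, which is small in \<open>L\<^sub>1\<close>.
\<close>

lemma H_approximation:
  assumes e: "\<And>x. x \<in> {0..1} \<Longrightarrow> y x = A * efun (int n) x + B * efun (- int n) x + R x / omega"
    and x: "x \<in> {0..1}"
  shows "cmod (H k x - A * qint q (int n + k) x - B * qint q (- int n + k) x) \<le> L * (K / omega) + \<bar>delta\<bar> * M"
proof -
  have sub: "{0..x} \<subseteq> {0..1}" using x by auto
  let ?g = "\<lambda>x. complex_of_real (q x) * (R x / omega) - delta * y x"
  have c: "continuous_on {0..1} (\<lambda>x. R x / omega)"
    using omega_pos by (intro continuous_intros R_continuous) auto
  have "?g absolutely_integrable_on {0..1}"
    by (intro set_integral_diff absolutely_integrable_mult_continuous qc_ai c
         absolutely_integrable_continuous_real continuous_intros y_continuous)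
  hence "cmod (integral {0..x} (\<lambda>t. ?g t * efun k t)) \<le> L * (K / omega) + \<bar>delta\<bar> * M"
  proof (rule primitive_bound[OF _ _ x])
    fix x :: real assume x: "x \<in> {0..1}"
    have "cmod (?g x) \<le> cmod (complex_of_real (q x) * (R x / omega)) + cmod (delta * y x)"
      by (rule norm_triangle_ineq4)
    also have "\<dots> \<le> \<bar>q x\<bar> * (K / omega) + \<bar>delta\<bar> * M"
      unfolding norm_mult norm_of_real norm_divide
      using R_bound[OF x] bound[OF x] omega_pos
      by (intro add_mono mult_mono divide_mono) auto
    finally show "cmod (?g x) \<le> \<bar>q x\<bar> * (K / omega) + \<bar>delta\<bar> * M" .
  qed
  moreover have "integral {0..x} (\<lambda>t. ?g t * efun k t) = H k x - A * qint q (int n + k) x - B * qint q (- int n + k) x"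
  proof (rule integral_unique, rule has_integral_eq)
    have hi: "(f has_integral integral {0..x} f) {0..x}" if "f absolutely_integrable_on {0..1}" for f :: "real \<Rightarrow> complex"
      by (intro integrable_integral absolutely_integrable_integrable(1)[OF that sub])
    show "((\<lambda>t. h t * efun k t - A * (complex_of_real (q t) * efun (int n + k) t) - B * (complex_of_real (q t) * efun (- int n + k) t)) has_integral
        H k x - A * qint q (int n + k) x - B * qint q (- int n + k) x) {0..x}"
      unfolding H_def qint_def
      by (intro has_integral_diff has_integral_mult_right hi absolutely_integrable_mult_continuous h_ai qc_ai continuous_on_efun)
    fix t assume "t \<in> {0..x}"
    hence t: "t \<in> {0..1}" using sub by auto
    have "R t / omega = y t - A * efun (int n) t - B * efun (- int n) t" using e[OF t] by simp
    hence "?g t * efun k t = (complex_of_real (q t) * (y t - A * efun (int n) t - B * efun (- int n) t) - delta * y t) * efun k t"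
      by simp
    also have "\<dots> = h t * efun k t - A * (complex_of_real (q t) * (efun (int n) t * efun k t)) - B * (complex_of_real (q t) * (efun (- int n) t * efun k t))"
      by (simp add: h_def algebra_simps)
    finally show "h t * efun k t - A * (complex_of_real (q t) * efun (int n + k) t) - B * (complex_of_real (q t) * efun (- int n + k) t)
      = ?g t * efun k t" by (simp only: efun_mult)
  qed
  ultimately show ?thesis by simp
qed

lemma qint_at_0: "qint q k 0 = 0"
  by (simp add: qint_def)

lemma qint_mean: "qint q 0 1 = 0"
  using integral_unique[OF q_mean_complex] by (simp add: qint_def)

lemma qint_continuous: "continuous_on {0..1} (qint q k)"
  using abs_cont_deriv_qint[OF q_ai] by (rule abs_cont_deriv_continuous)

text \<open>
  Here the mean value enters a second time: \<open>Q\<^sub>0 Q\<^sub>k\<close> vanishes at both end points.  For \<open>k = 0\<close> the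
  identity says that the non-oscillating double integral, the integral of \<open>q Q\<^sub>0\<close>, is zero.
\<close>

lemma q_qint_by_parts:
  "integral {0..1} (\<lambda>x. complex_of_real (q x) * (qint q 0 x * efun k x))
     = - integral {0..1} (\<lambda>x. complex_of_real (q x) * qint q k x)"
proof -
  have "abs_cont_deriv (\<lambda>x. qint q 0 x * qint q k x)
     (\<lambda>x. complex_of_real (q x) * efun 0 x * qint q k x + complex_of_real (q x) * efun k x * qint q 0 x)"
    by (intro abs_cont_deriv_mult abs_cont_deriv_qint q_ai)
  from abs_cont_derivD(2)[OF this, of 1] qint_mean
  have "0 = integral {0..1} (\<lambda>x. complex_of_real (q x) * qint q k x + complex_of_real (q x) * (qint q 0 x * efun k x))"
    by (simp add: qint_at_0 mult_ac)
  also have "\<dots> = integral {0..1} (\<lambda>x. complex_of_real (q x) * qint q k x)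
     + integral {0..1} (\<lambda>x. complex_of_real (q x) * (qint q 0 x * efun k x))"
    by (intro integral_unique has_integral_add q_has_integral continuous_intros qint_continuous)
  finally show ?thesis by (simp add: eq_neg_iff_add_eq_0 add.commute)
qed

lemma q_qint_osc:
  assumes k: "k = 2 * int n \<or> k = - (2 * int n)"
  shows "cmod (integral {0..1} (\<lambda>x. complex_of_real (q x) * (qint q k x * efun l x))) \<le> osc q n"
  unfolding osc_def
proof (rule Henstock_Kurzweil_Integration.integral_norm_bound_integral)
  have ai: "(\<lambda>x. complex_of_real (q x) * (qint q k x * efun l x)) absolutely_integrable_on {0..1}" for k l
    by (intro absolutely_integrable_mult_continuous qc_ai continuous_intros qint_continuous)
  show "(\<lambda>x. complex_of_real (q x) * (qint q k x * efun l x)) integrable_on {0..1}"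
    using absolutely_integrable_integrable(1)[OF ai subset_refl] .
  show "(\<lambda>x. \<bar>q x\<bar> * cmod (qint q (2 * int n) x)) integrable_on {0..1}"
    using absolutely_integrable_integrable(2)[OF ai subset_refl] by (simp add: norm_mult)
  show "cmod (complex_of_real (q x) * (qint q k x * efun l x)) \<le> \<bar>q x\<bar> * cmod (qint q (2 * int n) x)" for x
    using k cmod_qint_minus[of q "2 * int n" x] by (auto simp: norm_mult)
qed

text \<open>
  The factor \<open>1 / omega\<close> of the coarse estimate is kept, and what it multiplies now tends to \<open>0\<close>.
  Since \<open>2\<i> R e\<^sub>-\<^sub>n = H (- n) - H n e\<^sub>-\<^sub>2\<^sub>n\<close>, the approximation of \<open>H\<close> expresses the integral of
  \<open>q R e\<^sub>-\<^sub>n\<close> through four double integrals \<open>X0\<close>, ..., \<open>X3\<close>: the first vanishes, the next two are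
  oscillating, and \<open>X3 = - X1\<close> by parts.
\<close>

lemma coupling_fine:
  "cmod (delta * u - v * qcoeff q (2 * int n)) \<le>
     (K * cmod (qcoeff q (2 * int n)) + 2 * (M + K / omega) * osc q n
        + L * (L * (K / omega) + \<bar>delta\<bar> * M)) / omega"
proof -
  obtain A B where e: "\<And>x. x \<in> {0..1} \<Longrightarrow> y x = A * efun (int n) x + B * efun (- int n) x + R x / omega"
    and A: "cmod (u - A) \<le> K / omega" and B: "cmod (v - B) \<le> K / omega"
    by (rule mode_expansion) blast
  define G where "G = L * (K / omega) + \<bar>delta\<bar> * M"
  define J where "J = (\<lambda>f. integral {0..1} (\<lambda>x. complex_of_real (q x) * f x))"
  have J: "((\<lambda>x. complex_of_real (q x) * f x) has_integral J f) {0..1}" if "continuous_on {0..1} f" for f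
    unfolding J_def by (rule q_has_integral[OF that])
  define E where "E = (\<lambda>k x. H k x - A * qint q (int n + k) x - B * qint q (- int n + k) x)"
  have Hc: "continuous_on {0..1} (H k)" for k
    using abs_cont_deriv_H by (rule abs_cont_deriv_continuous)
  have Ec: "continuous_on {0..1} (E k)" for k
    unfolding E_def by (intro continuous_intros Hc qint_continuous)
  have Eb: "cmod (E k x) \<le> G" if "x \<in> {0..1}" for k x
    unfolding E_def G_def by (rule H_approximation[OF e that])
  let ?m = "int n"
  let ?X0 = "J (\<lambda>x. qint q 0 x)" and ?X1 = "J (\<lambda>x. qint q (- (2 * ?m)) x)"
    and ?X2 = "J (\<lambda>x. qint q (2 * ?m) x * efun (- (2 * ?m)) x)"
    and ?X3 = "J (\<lambda>x. qint q 0 x * efun (- (2 * ?m)) x)"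
    and ?E1 = "J (\<lambda>x. E (- ?m) x)" and ?E2 = "J (\<lambda>x. E ?m x * efun (- (2 * ?m)) x)"
    and ?W = "J (\<lambda>x. R x * efun (- ?m) x)"
  have "((\<lambda>x. A * (complex_of_real (q x) * qint q 0 x) + B * (complex_of_real (q x) * qint q (- (2 * ?m)) x) + complex_of_real (q x) * E (- ?m) x
      - (A * (complex_of_real (q x) * (qint q (2 * ?m) x * efun (- (2 * ?m)) x)) + B * (complex_of_real (q x) * (qint q 0 x * efun (- (2 * ?m)) x))
          + complex_of_real (q x) * (E ?m x * efun (- (2 * ?m)) x))) has_integral
      A * ?X0 + B * ?X1 + ?E1 - (A * ?X2 + B * ?X3 + ?E2)) {0..1}"
    by (intro has_integral_add has_integral_diff has_integral_mult_right J continuous_intros qint_continuous Ec)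
  moreover have "A * (complex_of_real (q x) * qint q 0 x) + B * (complex_of_real (q x) * qint q (- (2 * ?m)) x) + complex_of_real (q x) * E (- ?m) x
      - (A * (complex_of_real (q x) * (qint q (2 * ?m) x * efun (- (2 * ?m)) x)) + B * (complex_of_real (q x) * (qint q 0 x * efun (- (2 * ?m)) x))
          + complex_of_real (q x) * (E ?m x * efun (- (2 * ?m)) x))
      = 2 * \<i> * (complex_of_real (q x) * (R x * efun (- ?m) x))" for x
  proof -
    have R: "2 * \<i> * (R x * efun (- ?m) x) = H (- ?m) x - H ?m x * efun (- (2 * ?m)) x"
    proof -
      have "2 * \<i> * R x = H (- ?m) x * efun ?m x - H ?m x * efun (- ?m) x" by (simp add: R_def)
      hence "2 * \<i> * R x * efun (- ?m) x = (H (- ?m) x * efun ?m x - H ?m x * efun (- ?m) x) * efun (- ?m) x"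
        by (rule arg_cong)
      thus ?thesis by (simp add: left_diff_distrib mult.assoc efun_mult)
    qed
    have "2 * \<i> * (complex_of_real (q x) * (R x * efun (- ?m) x)) = complex_of_real (q x) * (2 * \<i> * (R x * efun (- ?m) x))"
      by simp
    thus ?thesis unfolding R E_def by (simp add: algebra_simps)
  qed
  ultimately have "((\<lambda>x. 2 * \<i> * (complex_of_real (q x) * (R x * efun (- ?m) x))) has_integral
      A * ?X0 + B * ?X1 + ?E1 - (A * ?X2 + B * ?X3 + ?E2)) {0..1}" by simp
  moreover have "((\<lambda>x. 2 * \<i> * (complex_of_real (q x) * (R x * efun (- ?m) x))) has_integral 2 * \<i> * ?W) {0..1}"
    by (intro has_integral_mult_right J continuous_intros R_continuous)
  ultimately have W: "2 * \<i> * ?W = A * ?X0 + B * ?X1 + ?E1 - (A * ?X2 + B * ?X3 + ?E2)"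
    by (rule has_integral_unique[rotated])
  have X0: "?X0 = 0"
    using q_qint_by_parts[of 0] by (simp add: J_def)
  have X3: "?X3 = - ?X1"
    using q_qint_by_parts by (simp add: J_def)
  have X1: "cmod ?X1 \<le> osc q n"
    using q_qint_osc[of "- (2 * ?m)" 0] by (simp add: J_def)
  have X2: "cmod ?X2 \<le> osc q n"
    unfolding J_def by (rule q_qint_osc) simp
  have E1: "cmod ?E1 \<le> G * L"
    unfolding J_def by (intro q_integral_bound Ec Eb)
  have E2: "cmod ?E2 \<le> G * L"
    unfolding J_def by (intro q_integral_bound continuous_intros Ec) (simp add: norm_mult Eb)
  have osc: "0 \<le> osc q n" using X1 norm_ge_zero order_trans by blast
  define S where "S = M + K / omega"
  have AS: "cmod A \<le> S" and BS: "cmod B \<le> S"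
    using norm_triangle_sub[of A u] norm_triangle_sub[of B v] u_bound[of ?m] u_bound[of "- ?m"] A B
    by (auto simp: S_def norm_minus_commute)
  have "2 * \<i> * ?W = (2 * B) * ?X1 - A * ?X2 + (?E1 - ?E2)"
    unfolding W X0 X3 by (simp add: algebra_simps)
  hence "2 * cmod ?W = cmod ((2 * B) * ?X1 - A * ?X2 + (?E1 - ?E2))"
    by (metis norm_ii norm_mult norm_numeral mult.right_neutral)
  also have "\<dots> \<le> cmod ((2 * B) * ?X1) + cmod (A * ?X2) + (cmod ?E1 + cmod ?E2)"
    by (intro order_trans[OF norm_triangle_ineq] add_mono norm_triangle_ineq4)
  also have "\<dots> \<le> 2 * S * osc q n + S * osc q n + (G * L + G * L)"
    unfolding norm_mult norm_numeral
    using AS BS X1 X2 E1 E2 osc order_trans[OF norm_ge_zero AS]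
    by (intro add_mono mult_mono) auto
  finally have "cmod ?W \<le> 2 * S * osc q n + L * G"
    using mult_nonneg_nonneg[OF order_trans[OF norm_ge_zero AS] osc] by (simp add: algebra_simps)
  hence Wb: "cmod (?W / omega) \<le> (2 * S * osc q n + L * G) / omega"
    using omega_pos by (simp add: norm_divide divide_right_mono)
  have "delta * u = B * qcoeff q (2 * ?m) + J (\<lambda>x. R x / omega * efun (- ?m) x)"
    unfolding J_def using omega_pos
    by (intro delta_u_expansion[OF e]) (auto intro!: continuous_intros R_continuous)
  also have "J (\<lambda>x. R x / omega * efun (- ?m) x) = ?W / omega"
  proof -
    have "((\<lambda>x. complex_of_real (q x) * (R x * efun (- ?m) x) / omega) has_integral ?W / omega) {0..1}"
      by (intro has_integral_divide J continuous_intros R_continuous)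
    from integral_unique[OF this] show ?thesis by (simp add: J_def)
  qed
  finally have "delta * u - v * qcoeff q (2 * ?m) = ?W / omega - (v - B) * qcoeff q (2 * ?m)"
    by (simp add: algebra_simps)
  also have "cmod \<dots> \<le> cmod (?W / omega) + cmod ((v - B) * qcoeff q (2 * ?m))"
    by (rule norm_triangle_ineq4)
  also have "\<dots> \<le> (2 * S * osc q n + L * G) / omega + K / omega * cmod (qcoeff q (2 * ?m))"
    unfolding norm_mult using Wb B by (intro add_mono mult_right_mono) auto
  also have "\<dots> = (K * cmod (qcoeff q (2 * ?m)) + 2 * S * osc q n + L * G) / omega"
    by (simp add: add_divide_distrib)
  finally show ?thesis by (simp add: S_def G_def)
qed

end

section \<open>Normalized eigenfunctions as the mode number grows\<close>

text \<open>
  Parseval's formula for the two modes \<open>e\<^sub>n\<close> and \<open>e\<^sub>-\<^sub>n\<close>, up to the error of the two-mode approximation;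
  orthogonality of \<open>y\<close> and \<open>z\<close> thus becomes a relation between their coefficients.
\<close>

lemma integral_two_mode:
  assumes q: "q absolutely_integrable_on {0..1}" "integral {0..1} q = 0"
    and y: "y \<in> eigenspace q mu" "\<And>x. x \<in> {0..1} \<Longrightarrow> cmod (y x) \<le> M"
    and z: "continuous_on {0..1} z" "\<And>x. x \<in> {0..1} \<Longrightarrow> cmod (z x) \<le> M'"
    and n: "n > 0"
  shows "cmod (integral {0..1} (\<lambda>x. y x * z x)
            - (ip01 y (efun (int n)) * ip01 z (efun (- int n)) + ip01 y (efun (- int n)) * ip01 z (efun (int n))))
     \<le> 3 * ((integral {0..1} (\<lambda>x. \<bar>q x\<bar>) + \<bar>mu - (2 * pi * real n)\<^sup>2\<bar>) * M) / (2 * pi * real n) * M'"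
proof -
  interpret eigenfunction_mode q y mu n M
    by unfold_locales (use assms in auto)
  let ?r = "\<lambda>x. y x - u * efun (int n) x - v * efun (- int n) x"
  have c: "continuous_on {0..1} ?r" by (intro continuous_intros y_continuous)
  have ez: "((\<lambda>x. z x * efun (- k) x) has_integral ip01 z (efun k)) {0..1}" for k
    unfolding ip01_efun by (intro integrable_integral integrable_continuous_real continuous_intros z)
  have "((\<lambda>x. u * (z x * efun (- (- int n)) x) + v * (z x * efun (- int n) x) + ?r x * z x) has_integral
      u * ip01 z (efun (- int n)) + v * ip01 z (efun (int n)) + integral {0..1} (\<lambda>x. ?r x * z x)) {0..1}"
    by (intro has_integral_add has_integral_mult_right ez)
       (intro integrable_integral integrable_continuous_real continuous_intros c z)
  moreover have "u * (z x * efun (- (- int n)) x) + v * (z x * efun (- int n) x) + ?r x * z x = y x * z x" for x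
    by (simp add: algebra_simps)
  ultimately have "integral {0..1} (\<lambda>x. y x * z x)
      - (u * ip01 z (efun (- int n)) + v * ip01 z (efun (int n))) = integral {0..1} (\<lambda>x. ?r x * z x)"
    by (simp add: integral_unique)
  also have "cmod \<dots> \<le> (3 * K / omega * M') * (1 - 0)"
  proof (rule integral_bound)
    fix x :: real assume x: "x \<in> {0..1}"
    show "cmod (?r x * z x) \<le> 3 * K / omega * M'"
      unfolding norm_mult using two_mode_approximation[OF x] z(2)[OF x] K_nonneg omega_pos
      by (intro mult_mono) auto
  qed (auto intro!: continuous_intros c z)
  finally show ?thesis by (simp add: K_def delta_def omega_def L_def)
qed

text \<open>
  At a point where \<open>|y|\<close> is maximal, the two-mode approximation gives \<open>max |y| \<le> 2|u| + max |y| / 2\<close>;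
  the hypothesis \<open>large\<close> makes the error at most half the maximum.  So \<open>max |y| \<le> 4|u|\<close>, while
  \<open>1 \<le> max |y|\<close> and \<open>|u| \<le> 1\<close> follow from the normalization.
\<close>

lemma normalized_eigenfunction_bounds:
  assumes q: "q absolutely_integrable_on {0..1}" "integral {0..1} q = 0"
    and y: "(\<lambda>x. complex_of_real (p x)) \<in> eigenspace q mu" "norm01 (\<lambda>x. complex_of_real (p x)) = 1"
    and n: "n > 0"
    and large: "6 * (integral {0..1} (\<lambda>x. \<bar>q x\<bar>) + \<bar>mu - (2 * pi * real n)\<^sup>2\<bar>) \<le> 2 * pi * real n"
  shows "1 / 4 \<le> cmod (ip01 (\<lambda>x. complex_of_real (p x)) (efun (int n)))"
    and "\<And>x. x \<in> {0..1} \<Longrightarrow> \<bar>p x\<bar> \<le> 4"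
proof -
  let ?y = "\<lambda>x. complex_of_real (p x)"
  have yc: "continuous_on {0..1} ?y"
    using y(1) by (elim eigenspace_cases) (rule abs_cont_deriv_continuous)
  have pc: "continuous_on {0..1} (\<lambda>x. \<bar>p x\<bar>)"
    using continuous_on_norm[OF yc] by simp
  obtain x0 where x0: "x0 \<in> {0..1}" and max: "\<And>x. x \<in> {0..1} \<Longrightarrow> \<bar>p x\<bar> \<le> \<bar>p x0\<bar>"
    using continuous_attains_sup[OF compact_Icc _ pc] by force
  interpret eigenfunction_mode q ?y mu n "\<bar>p x0\<bar>"
    by unfold_locales (use assms max in auto)
  let ?M = "\<bar>p x0\<bar>"
  have v: "v = cnj u"
    unfolding ip01_efun by (simp add: integral_cnj cnj_efun)
  have "6 * (L + \<bar>delta\<bar>) \<le> omega"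
    using large by (simp only: L_def delta_def omega_def)
  hence "6 * K \<le> omega * ?M"
    unfolding K_def mult.assoc[symmetric] by (rule mult_right_mono) simp
  hence K: "3 * K / omega \<le> ?M / 2" using omega_pos by (simp add: field_simps)
  have "?M = cmod (?y x0)" by simp
  also have "\<dots> = cmod ((?y x0 - u * efun (int n) x0 - v * efun (- int n) x0) + u * efun (int n) x0 + v * efun (- int n) x0)"
    by simp
  also have "\<dots> \<le> 3 * K / omega + cmod u + cmod v"
    using two_mode_approximation[OF x0] 
    by (intro norm_triangle_le add_mono) (auto simp: norm_mult)
  also have "\<dots> \<le> ?M / 2 + 2 * cmod u" using K by (simp add: v)
  finally have M4: "?M \<le> 4 * cmod u" by simp
  have sq: "((\<lambda>x. (cmod (?y x))\<^sup>2) has_integral 1) {0..1}"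
  proof -
    have "(\<lambda>x. (cmod (?y x))\<^sup>2) integrable_on {0..1}"
      by (intro integrable_continuous_real continuous_intros yc)
    moreover have "integral {0..1} (\<lambda>x. (cmod (?y x))\<^sup>2) = 1" using y(2) by (simp add: norm01_def)
    ultimately show ?thesis by (metis integrable_integral)
  qed
  have one: "((\<lambda>x. c) has_integral c) {0..1::real}" for c :: real
    using has_integral_const_real[of c 0 1] by simp
  have "1 \<le> ?M\<^sup>2"
    by (rule has_integral_le[OF sq one]) (auto simp: abs_le_square_iff[symmetric] max)
  hence M1: "1 \<le> ?M" using power2_le_imp_le[of 1 ?M] by simp
  show "1 / 4 \<le> cmod u" using M1 M4 by simp
  have "cmod u \<le> 1"
  proof -
    have "norm (integral {0..1} (\<lambda>x. ?y x * efun (- int n) x)) \<le> integral {0..1} (\<lambda>x. (1 + (cmod (?y x))\<^sup>2) / 2)"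
    proof (rule Henstock_Kurzweil_Integration.integral_norm_bound_integral)
      show "(\<lambda>x. ?y x * efun (- int n) x) integrable_on {0..1}"
        by (intro integrable_continuous_real continuous_intros yc)
      show "(\<lambda>x. (1 + (cmod (?y x))\<^sup>2) / 2) integrable_on {0..1}"
        by (intro integrable_continuous_real continuous_intros yc) auto
      show "norm (?y x * efun (- int n) x) \<le> (1 + (cmod (?y x))\<^sup>2) / 2" for x
        using sum_squares_ge_zero[of "1 - cmod (?y x)" 0]
        by (simp add: norm_mult power2_eq_square algebra_simps)
    qed
    also have "\<dots> = (1 + 1) / 2"
      by (intro integral_unique has_integral_divide has_integral_add one sq)
    finally show ?thesis by (simp add: ip01_efun)
  qed
  thus "\<bar>p x\<bar> \<le> 4" if "x \<in> {0..1}" for x using max[OF that] M4 by simp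
qed

lemma sqrt_smallo_real: "(\<lambda>n. sqrt (real n)) \<in> o(real)"
proof (rule smalloI_tendsto)
  have "(\<lambda>n. inverse (sqrt (real n))) \<longlonglongrightarrow> 0"
    by (intro tendsto_inverse_0_at_top filterlim_compose[OF sqrt_at_top] filterlim_real_sequentially)
  moreover have "\<forall>\<^sub>F n in sequentially. inverse (sqrt (real n)) = sqrt (real n) / real n"
    using eventually_gt_at_top[of 0]
    by eventually_elim (simp add: field_simps)
  ultimately show "(\<lambda>n. sqrt (real n) / real n) \<longlonglongrightarrow> 0"
    by (rule Lim_transform_eventually)
  show "\<forall>\<^sub>F n in sequentially. real n \<noteq> 0"
    using eventually_gt_at_top[of 0] by eventually_elim simp
qed

text \<open>
  The order of the conclusions is the order of the argument: the growth condition bounds the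
  eigenfunctions, then the coarse estimate gives \<open>\<alpha> \<rightarrow> 0\<close>, whence \<open>\<delta> \<rightarrow> 0\<close> since \<open>q\<^sub>2\<^sub>n \<rightarrow> 0\<close>, and
  only then does every term of the fine estimate tend to \<open>0\<close>.
\<close>

lemma eigenpair_asymptotics:
  fixes p :: "nat \<Rightarrow> real \<Rightarrow> real" and mu :: "nat \<Rightarrow> real"
  assumes q: "q absolutely_integrable_on {0..1}" "integral {0..1} q = 0"
    and y: "\<And>n. n \<ge> N \<Longrightarrow> (\<lambda>x. complex_of_real (p n x)) \<in> eigenspace q (mu n)"
           "\<And>n. n \<ge> N \<Longrightarrow> norm01 (\<lambda>x. complex_of_real (p n x)) = 1"
    and growth: "(\<lambda>n. mu n - (2 * pi * real n)\<^sup>2) \<in> O(\<lambda>n. sqrt (real n))"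
    and u: "\<And>n. n \<ge> N \<Longrightarrow> u n = ip01 (\<lambda>x. complex_of_real (p n x)) (efun (int n))"
    and alpha: "\<And>n. n \<ge> N \<Longrightarrow> complex_of_real (mu n - (2 * pi * real n)\<^sup>2) * u n
            = qcoeff q (2 * int n) * cnj (u n) + alpha n"
  shows "\<forall>\<^sub>F n in sequentially. 1 / 4 \<le> cmod (u n)"
    and "\<forall>\<^sub>F n in sequentially. \<forall>x\<in>{0..1}. \<bar>p n x\<bar> \<le> 4"
    and "(\<lambda>n. mu n - (2 * pi * real n)\<^sup>2) \<longlonglongrightarrow> 0"
    and "(\<lambda>n. real n * cmod (alpha n)) \<longlonglongrightarrow> 0"
proof -
  define d where "d = (\<lambda>n. mu n - (2 * pi * real n)\<^sup>2)"
  define ell where "ell = integral {0..1} (\<lambda>x. \<bar>q x\<bar>)"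
  define kap where "kap = (\<lambda>n. ((ell + \<bar>d n\<bar>) * 4) / (2 * pi * real n))"
  define Q where "Q = (\<lambda>n. qcoeff q (2 * int n))"
  have dn: "(\<lambda>n. d n / real n) \<longlonglongrightarrow> 0"
    unfolding d_def using landau_o.big_small_trans[OF growth sqrt_smallo_real]
    by (rule smalloD_tendsto)
  have kap0: "kap \<longlonglongrightarrow> 0"
  proof -
    have "(\<lambda>n. (ell * inverse (real n) + \<bar>d n / real n\<bar>) * (4 / (2 * pi))) \<longlonglongrightarrow> (ell * 0 + \<bar>0\<bar>) * (4 / (2 * pi))"
      by (intro tendsto_intros dn lim_inverse_n) auto
    moreover have "(\<lambda>n. (ell * inverse (real n) + \<bar>d n / real n\<bar>) * (4 / (2 * pi))) = kap"
    proof
      fix n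
      have "ell * inverse (real n) + \<bar>d n / real n\<bar> = (ell + \<bar>d n\<bar>) / real n"
        by (simp add: divide_inverse abs_mult distrib_right)
      moreover have "(ell + \<bar>d n\<bar>) / real n * (4 / (2 * pi)) = kap n"
        unfolding kap_def times_divide_times_eq by (simp only: mult_ac)
      ultimately show "(ell * inverse (real n) + \<bar>d n / real n\<bar>) * (4 / (2 * pi)) = kap n"
        by (simp only:)
    qed
    ultimately have "kap \<longlonglongrightarrow> (ell * 0 + \<bar>0\<bar>) * (4 / (2 * pi))" by (simp only:)
    thus ?thesis by simp
  qed
  have good: "\<forall>\<^sub>F n in sequentially. n \<ge> N \<and> n > 0 \<and> 1 / 4 \<le> cmod (u n) \<and> (\<forall>x\<in>{0..1}. \<bar>p n x\<bar> \<le> 4)"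
  proof -
    \<comment> \<open>\<open>kap n < 2/3\<close> is the largeness condition on the mode number\<close>
    have "\<forall>\<^sub>F n in sequentially. kap n < 2 / 3"
      using order_tendstoD(2)[OF kap0, of "2/3"] by simp
    thus ?thesis using eventually_ge_at_top[of N] eventually_gt_at_top[of 0]
    proof eventually_elim
      case (elim n)
      have large: "6 * (integral {0..1} (\<lambda>x. \<bar>q x\<bar>) + \<bar>mu n - (2 * pi * real n)\<^sup>2\<bar>) \<le> 2 * pi * real n"
        using elim unfolding kap_def ell_def d_def by (simp add: field_simps)
      from normalized_eigenfunction_bounds[OF q y(1)[OF elim(2)] y(2)[OF elim(2)] elim(3) large]
      show ?case using elim by (simp add: u)
    qed
  qed
  show "\<forall>\<^sub>F n in sequentially. 1 / 4 \<le> cmod (u n)"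
    using good by eventually_elim simp
  show "\<forall>\<^sub>F n in sequentially. \<forall>x\<in>{0..1}. \<bar>p n x\<bar> \<le> 4"
    using good by eventually_elim simp
  have bounds: "\<forall>\<^sub>F n in sequentially.
      cmod (alpha n) \<le> 3 * ell * kap n \<and> 
      real n * cmod (alpha n) \<le> ((ell + \<bar>d n\<bar>) * 4) * cmod (Q n) + 2 * (4 + kap n) * osc q n
        + ell * (ell * kap n + \<bar>d n\<bar> * 4) \<and> \<bar>d n\<bar> \<le> cmod (Q n) + 4 * cmod (alpha n)"
    using good
  proof eventually_elim
    case (elim n)
    let ?y = "\<lambda>x. complex_of_real (p n x)"
    interpret eigenfunction_mode q ?y "mu n" n 4
      by unfold_locales (use elim q y in auto)
    have LL: "L = ell" "delta = d n"
      by (simp_all only: L_def ell_def delta_def d_def omega_def)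
    have kk: "K / omega = kap n" by (simp add: K_def kap_def LL omega_def)
    have v: "ip01 ?y (efun (- int n)) = cnj (u n)"
      using elim by (simp add: u ip01_efun integral_cnj cnj_efun)
    have a: "alpha n = delta * ip01 ?y (efun (int n)) - ip01 ?y (efun (- int n)) * qcoeff q (2 * int n)"
      using alpha[of n] elim v u[of n] by (simp add: LL d_def mult.commute)
    have "cmod (alpha n) \<le> 3 * K / omega * L"
      unfolding a by (rule coupling_coarse)
    also have "\<dots> = 3 * ell * kap n" by (simp add: LL flip: kk)
    finally have 1: "cmod (alpha n) \<le> 3 * ell * kap n" .
    have "cmod (alpha n) \<le> (K * cmod (qcoeff q (2 * int n)) + 2 * (4 + K / omega) * osc q n
        + L * (L * (K / omega) + \<bar>delta\<bar> * 4)) / omega"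
      unfolding a by (rule coupling_fine)
    hence "cmod (alpha n) \<le> (K * cmod (Q n) + 2 * (4 + kap n) * osc q n
        + ell * (ell * kap n + \<bar>d n\<bar> * 4)) / omega"
      unfolding kk LL Q_def .
    hence "omega * cmod (alpha n) \<le> K * cmod (Q n) + 2 * (4 + kap n) * osc q n + ell * (ell * kap n + \<bar>d n\<bar> * 4)"
      using omega_pos by (simp add: field_simps)
    moreover have "real n * cmod (alpha n) \<le> omega * cmod (alpha n)"
    proof (rule mult_right_mono)
      have "1 * real n \<le> 2 * pi * real n" using pi_ge_two by (intro mult_right_mono) auto
      thus "real n \<le> omega" by (simp add: omega_def)
    qed simp
    ultimately have 2: "real n * cmod (alpha n) \<le> ((ell + \<bar>d n\<bar>) * 4) * cmod (Q n) + 2 * (4 + kap n) * osc q n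
        + ell * (ell * kap n + \<bar>d n\<bar> * 4)"
      by (simp add: K_def LL)
    have "\<bar>d n\<bar> * cmod (u n) = cmod (Q n * cnj (u n) + alpha n)"
      using alpha[of n] elim unfolding Q_def d_def by (metis norm_mult norm_of_real)
    also have "\<dots> \<le> cmod (Q n) * cmod (u n) + cmod (alpha n)"
      by (metis complex_mod_cnj norm_mult norm_triangle_ineq)
    also have "\<dots> \<le> cmod (Q n) * cmod (u n) + (4 * cmod (alpha n)) * cmod (u n)"
      using mult_left_mono[of "1/4" "cmod (u n)" "4 * cmod (alpha n)"] elim by simp
    finally have "\<bar>d n\<bar> * cmod (u n) \<le> (cmod (Q n) + 4 * cmod (alpha n)) * cmod (u n)"
      by (simp add: algebra_simps)
    moreover have "cmod (u n) > 0" using elim by linarith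
    ultimately have 3: "\<bar>d n\<bar> \<le> cmod (Q n) + 4 * cmod (alpha n)" by simp
    show ?case using 1 2 3 by blast
  qed
  have Q0: "(\<lambda>n. cmod (Q n)) \<longlonglongrightarrow> 0"
    unfolding Q_def by (rule qcoeff_tendsto_0[OF q(1)])
  have a0: "(\<lambda>n. cmod (alpha n)) \<longlonglongrightarrow> 0"
  proof (rule tendsto_sandwich[OF _ _ tendsto_const])
    show "(\<lambda>n. 3 * ell * kap n) \<longlonglongrightarrow> 0" using tendsto_mult_right_zero[OF kap0] .
    show "\<forall>\<^sub>F n in sequentially. cmod (alpha n) \<le> 3 * ell * kap n" using bounds by eventually_elim simp
  qed simp
  have d0: "(\<lambda>n. \<bar>d n\<bar>) \<longlonglongrightarrow> 0"
  proof (rule tendsto_sandwich[OF _ _ tendsto_const])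
    show "(\<lambda>n. cmod (Q n) + 4 * cmod (alpha n)) \<longlonglongrightarrow> 0"
      using tendsto_add[OF Q0 tendsto_mult_right_zero[OF a0, of 4]] by simp
    show "\<forall>\<^sub>F n in sequentially. \<bar>d n\<bar> \<le> cmod (Q n) + 4 * cmod (alpha n)" using bounds by eventually_elim simp
  qed simp
  thus "(\<lambda>n. mu n - (2 * pi * real n)\<^sup>2) \<longlonglongrightarrow> 0"
    unfolding d_def by (simp add: tendsto_rabs_zero_iff)
  show "(\<lambda>n. real n * cmod (alpha n)) \<longlonglongrightarrow> 0"
  proof (rule tendsto_sandwich[OF _ _ tendsto_const])
    have "(\<lambda>n. ((ell + \<bar>d n\<bar>) * 4) * cmod (Q n) + 2 * (4 + kap n) * osc q n
        + ell * (ell * kap n + \<bar>d n\<bar> * 4)) \<longlonglongrightarrow> ((ell + 0) * 4) * 0 + 2 * (4 + 0) * 0 + ell * (ell * 0 + 0 * 4)"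
      by (intro tendsto_intros d0 Q0 kap0 osc_tendsto_0 q)
    thus "(\<lambda>n. ((ell + \<bar>d n\<bar>) * 4) * cmod (Q n) + 2 * (4 + kap n) * osc q n
        + ell * (ell * kap n + \<bar>d n\<bar> * 4)) \<longlonglongrightarrow> 0" by simp
    show "\<forall>\<^sub>F n in sequentially. real n * cmod (alpha n) \<le> ((ell + \<bar>d n\<bar>) * 4) * cmod (Q n) + 2 * (4 + kap n) * osc q n
        + ell * (ell * kap n + \<bar>d n\<bar> * 4)" using bounds by eventually_elim simp
  qed simp
qed

section \<open>A pair of eigenvalues\<close>

lemma coupling_modulus:
  fixes d :: real and z w a :: complex
  assumes "complex_of_real d * z = w * cnj z + a" "1 / 4 \<le> cmod z"
  shows "\<bar>\<bar>d\<bar> - cmod w\<bar> \<le> 4 * cmod a"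
proof -
  have "\<bar>\<bar>d\<bar> - cmod w\<bar> * cmod z = \<bar>cmod (complex_of_real d * z) - cmod (w * cnj z)\<bar>"
    by (simp add: norm_mult abs_mult flip: left_diff_distrib)
  also have "\<dots> \<le> cmod (complex_of_real d * z - w * cnj z)" by (rule norm_triangle_ineq3)
  also have "\<dots> = cmod a" using assms(1) by simp
  finally have "\<bar>\<bar>d\<bar> - cmod w\<bar> * cmod z \<le> cmod a" .
  moreover have "\<bar>\<bar>d\<bar> - cmod w\<bar> * (1 / 4) \<le> \<bar>\<bar>d\<bar> - cmod w\<bar> * cmod z"
    by (intro mult_left_mono assms) auto
  ultimately show ?thesis by simp
qed

text \<open>
  With \<open>p = z1 * cnj z2\<close>, multiplying the first relation by \<open>cnj z2\<close> and the second by \<open>cnj z1\<close> makes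
  the terms containing \<open>w\<close> equal.  Their difference has imaginary part \<open>(d1 + d2) * Im p\<close>, and
  \<open>Im p\<close> is bounded below because \<open>Re p\<close> is small and \<open>|p| \<ge> 1/16\<close>.
\<close>

lemma coupling_sum:
  fixes d1 d2 :: real and z1 z2 w a1 a2 :: complex
  assumes 1: "complex_of_real d1 * z1 = w * cnj z1 + a1"
    and 2: "complex_of_real d2 * z2 = w * cnj z2 + a2"
    and z: "1 / 4 \<le> cmod z1" "1 / 4 \<le> cmod z2" "cmod z1 \<le> 4" "cmod z2 \<le> 4"
    and orth: "\<bar>Re (z1 * cnj z2)\<bar> \<le> 1 / 32"
  shows "\<bar>d1 + d2\<bar> \<le> 128 * (cmod a1 + cmod a2)"
proof -
  define p where "p = z1 * cnj z2"
  have "complex_of_real d1 * p - complex_of_real d2 * cnj p = a1 * cnj z2 - a2 * cnj z1"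
  proof -
    have "complex_of_real d1 * p = (w * cnj z1 + a1) * cnj z2" unfolding p_def by (simp flip: 1)
    moreover have "complex_of_real d2 * cnj p = (w * cnj z2 + a2) * cnj z1" unfolding p_def by (simp flip: 2)
    ultimately show ?thesis by (simp add: algebra_simps)
  qed
  moreover have "Im (complex_of_real d1 * p - complex_of_real d2 * cnj p) = (d1 + d2) * Im p"
    by (simp add: algebra_simps)
  ultimately have "Im (a1 * cnj z2 - a2 * cnj z1) = (d1 + d2) * Im p" by simp
  hence "\<bar>d1 + d2\<bar> * \<bar>Im p\<bar> \<le> cmod (a1 * cnj z2 - a2 * cnj z1)"
    by (metis abs_Im_le_cmod abs_mult)
  also have "\<dots> \<le> cmod a1 * cmod z2 + cmod a2 * cmod z1"
    using norm_triangle_ineq4[of "a1 * cnj z2" "a2 * cnj z1"] by (simp add: norm_mult)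
  also have "\<dots> \<le> cmod a1 * 4 + cmod a2 * 4"
    by (intro add_mono mult_left_mono z) auto
  finally have le: "\<bar>d1 + d2\<bar> * \<bar>Im p\<bar> \<le> 4 * (cmod a1 + cmod a2)" by simp
  have "1 / 32 \<le> \<bar>Im p\<bar>"
  proof -
    have "1 / 4 * (1 / 4) \<le> cmod z1 * cmod z2" by (intro mult_mono z) auto
    also have "\<dots> = cmod p" by (simp add: p_def norm_mult)
    also have "\<dots> \<le> \<bar>Re p\<bar> + \<bar>Im p\<bar>" by (rule cmod_le)
    finally show ?thesis using orth by (simp add: p_def)
  qed
  hence "\<bar>d1 + d2\<bar> * (1 / 32) \<le> \<bar>d1 + d2\<bar> * \<bar>Im p\<bar>" by (intro mult_left_mono) auto
  with le show ?thesis by simp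
qed

lemma opposite_signs:
  fixes d1 d2 w s :: real
  assumes "\<bar>\<bar>d1\<bar> - w\<bar> \<le> e1" "\<bar>\<bar>d2\<bar> - w\<bar> \<le> e2" "\<bar>d1 + d2\<bar> \<le> s" "d1 \<le> d2"
    "e1 + e2 + s < w"
  shows "d1 < d2" "\<bar>d1 + w\<bar> \<le> e1" "\<bar>d2 - w\<bar> \<le> e2"
  using assms by linarith+

theorem theorem1:
  fixes q :: "real \<Rightarrow> real"
    and lam :: "nat \<Rightarrow> nat \<Rightarrow> real"
    and Psi :: "nat \<Rightarrow> nat \<Rightarrow> real \<Rightarrow> real"
    and u alpha :: "nat \<Rightarrow> nat \<Rightarrow> complex"
    and N0 :: nat
  assumes q_periodic: "\<And>x. q (x + 1) = q x"
    and q_L1: "q absolutely_integrable_on {0..1}"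
    and q_mean: "integral {0..1} q = 0"
    and lam: "large_periodic_eigenvalues q N0 lam"
    and Psi_eigen: "\<And>n j. n \<ge> N0 \<Longrightarrow> j \<in> {1, 2} \<Longrightarrow>
          (\<lambda>x. complex_of_real (Psi n j x)) \<in> eigenspace q (lam n j)"
    and Psi_norm: "\<And>n j. n \<ge> N0 \<Longrightarrow> j \<in> {1, 2} \<Longrightarrow>
          norm01 (\<lambda>x. complex_of_real (Psi n j x)) = 1"
    and Psi_orth: "\<And>n. n \<ge> N0 \<Longrightarrow> lam n 1 = lam n 2 \<Longrightarrow>
          ip01 (\<lambda>x. complex_of_real (Psi n 1 x)) (\<lambda>x. complex_of_real (Psi n 2 x)) = 0"
    and u: "\<And>n j. n \<ge> N0 \<Longrightarrow> j \<in> {1, 2} \<Longrightarrow>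
          u n j = ip01 (\<lambda>x. complex_of_real (Psi n j x)) (efun (int n))"
    and alpha: "\<And>n j. n \<ge> N0 \<Longrightarrow> j \<in> {1, 2} \<Longrightarrow>
          complex_of_real (lam n j - (2 * pi * real n)\<^sup>2) * u n j
            = qcoeff q (2 * int n) * cnj (u n j) + alpha n j"
  shows "(\<exists>a :: nat \<Rightarrow> nat \<Rightarrow> real.
            (\<forall>n j. a n j \<in> {1, -1}) \<and>
            (\<forall>j\<in>{1, 2}.
               (\<lambda>n. lam n j - (2 * pi * real n)\<^sup>2 - a n j * cmod (qcoeff q (2 * int n)))
                 \<in> O(\<lambda>n. cmod (alpha n j))))
       \<and> ((\<forall>\<^sub>F n in sequentially. qcoeff q (2 * int n) \<noteq> 0) \<and>
          (\<lambda>n. (cmod (alpha n 1) + cmod (alpha n 2)) / cmod (qcoeff q (2 * int n)))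
             \<longlonglongrightarrow> 0
          \<longrightarrow> (\<exists>N\<ge>N0. \<forall>n\<ge>N. \<forall>j\<in>{1, 2}. eig_mult q (lam n j) = 1) \<and>
              (\<forall>j\<in>{1, 2}.
                 (\<lambda>n. lam n j - ((2 * pi * real n)\<^sup>2 + (-1) ^ j * cmod (qcoeff q (2 * int n))))
                   \<in> o(\<lambda>n. 1 / real n)))"
proof -
  have j1: "(1::nat) \<in> {1, 2}" and j2: "(2::nat) \<in> {1, 2}" by simp_all
  define d where "d = (\<lambda>n j. lam n j - (2 * pi * real n)\<^sup>2)"
  define w where "w = (\<lambda>n. cmod (qcoeff q (2 * int n)))"
  have growth: "(\<lambda>n. lam n j - (2 * pi * real n)\<^sup>2) \<in> O(\<lambda>n. sqrt (real n))" if "j \<in> {1, 2}" for j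
    using lam that unfolding large_periodic_eigenvalues_def by blast
  have ordered: "lam n 1 \<le> lam n 2" if "n \<ge> N0" for n
    using lam that unfolding large_periodic_eigenvalues_def by blast
  note asym = eigenpair_asymptotics[where N = N0, OF q_L1 q_mean Psi_eigen Psi_norm growth u alpha]
  have lower: "\<forall>\<^sub>F n in sequentially. 1 / 4 \<le> cmod (u n j)"
    and sup: "\<forall>\<^sub>F n in sequentially. \<forall>x\<in>{0..1}. \<bar>Psi n j x\<bar> \<le> 4"
    and d0: "(\<lambda>n. d n j) \<longlonglongrightarrow> 0"
    and na0: "(\<lambda>n. real n * cmod (alpha n j)) \<longlonglongrightarrow> 0" if "j \<in> {1, 2}" for j
    unfolding d_def by (rule asym; use that in simp)+
  have modulus: "\<forall>\<^sub>F n in sequentially. \<bar>\<bar>d n j\<bar> - w n\<bar> \<le> 4 * cmod (alpha n j)" if "j \<in> {1, 2}" for j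
    using lower[OF that] eventually_ge_at_top[of N0] 
  proof eventually_elim
    case (elim n)
    show ?case unfolding d_def w_def by (rule coupling_modulus[OF alpha[OF elim(2) that] elim(1)])
  qed

  define a :: "nat \<Rightarrow> nat \<Rightarrow> real" where "a = (\<lambda>n j. if d n j \<ge> 0 then 1 else - 1)"
  have part_a: "(\<lambda>n. lam n j - (2 * pi * real n)\<^sup>2 - a n j * cmod (qcoeff q (2 * int n)))
                 \<in> O(\<lambda>n. cmod (alpha n j))" if "j \<in> {1, 2}" for j
  proof (rule bigoI[where c = 4])
    show "\<forall>\<^sub>F n in sequentially. norm (lam n j - (2 * pi * real n)\<^sup>2 - a n j * cmod (qcoeff q (2 * int n)))
        \<le> 4 * norm (cmod (alpha n j))"
      using modulus[OF that]
    proof eventually_elim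
      case (elim n)
      have "lam n j - (2 * pi * real n)\<^sup>2 - a n j * cmod (qcoeff q (2 * int n)) = d n j - a n j * w n"
        by (simp only: d_def w_def)
      also have "\<bar>\<dots>\<bar> \<le> 4 * cmod (alpha n j)" using elim by (auto simp: a_def)
      finally show ?case by simp
    qed
  qed

  have part_b: "(\<exists>N\<ge>N0. \<forall>n\<ge>N. \<forall>j\<in>{1, 2}. eig_mult q (lam n j) = 1) \<and>
              (\<forall>j\<in>{1, 2}.
                 (\<lambda>n. lam n j - ((2 * pi * real n)\<^sup>2 + (-1) ^ j * cmod (qcoeff q (2 * int n))))
                   \<in> o(\<lambda>n. 1 / real n))"
    if nz: "\<forall>\<^sub>F n in sequentially. qcoeff q (2 * int n) \<noteq> 0"
      and dom: "(\<lambda>n. (cmod (alpha n 1) + cmod (alpha n 2)) / cmod (qcoeff q (2 * int n))) \<longlonglongrightarrow> 0"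
  proof -
    define ell where "ell = integral {0..1} (\<lambda>x. \<bar>q x\<bar>)"
    have orth: "integral {0..1} (\<lambda>x. complex_of_real (Psi n 1 x) * complex_of_real (Psi n 2 x)) = 0"
      if "n \<ge> N0" for n
    proof (cases "lam n 1 = lam n 2")
      case True
      from Psi_orth[OF \<open>n \<ge> N0\<close> this] show ?thesis by (simp add: ip01_def)
    next
      case False
      show ?thesis
        by (rule eigenfunctions_orthogonal[OF Psi_eigen Psi_eigen False]) (use that in auto)
    qed
    \<comment> \<open>the error of the two-mode Parseval formula, with both eigenfunctions bounded by \<open>4\<close>\<close>
    define eps where "eps = (\<lambda>n. 3 * ((ell + \<bar>d n 1\<bar>) * 4) / (2 * pi * real n) * 4)"
    have eps0: "eps \<longlonglongrightarrow> 0"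
    proof -
      have lim: "(\<lambda>n. (ell + \<bar>d n 1\<bar>) * (24 / pi) * inverse (real n)) \<longlonglongrightarrow> (ell + \<bar>0\<bar>) * (24 / pi) * 0"
        by (intro tendsto_intros d0 lim_inverse_n) auto
      have eq: "(\<lambda>n. (ell + \<bar>d n 1\<bar>) * (24 / pi) * inverse (real n)) = eps"
      proof
        fix n
        show "(ell + \<bar>d n 1\<bar>) * (24 / pi) * inverse (real n) = eps n"
          by (cases "n = 0") (simp_all add: eps_def field_simps)
      qed
      show ?thesis using lim unfolding eq mult_zero_right .
    qed
    have Re_bound: "\<forall>\<^sub>F n in sequentially. cmod (u n 1) \<le> 4 \<and> cmod (u n 2) \<le> 4 \<and>
        \<bar>2 * Re (u n 1 * cnj (u n 2))\<bar> \<le> eps n"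
      using sup[OF j1] sup[OF j2] eventually_ge_at_top[of N0] eventually_gt_at_top[of 0]
    proof eventually_elim
      case (elim n)
      let ?y = "\<lambda>j x. complex_of_real (Psi n j x)"
      have eig: "?y j \<in> eigenspace q (lam n j)" if "j \<in> {1, 2}" for j
        using Psi_eigen elim that by auto
      have b: "cmod (?y j x) \<le> 4" if "j \<in> {1, 2}" "x \<in> {0..1}" for j x
        using elim that by auto
      interpret y1: eigenfunction_mode q "?y 1" "lam n 1" n 4
        by unfold_locales (use elim q_L1 q_mean eig b in auto)
      interpret y2: eigenfunction_mode q "?y 2" "lam n 2" n 4
        by unfold_locales (use elim q_L1 q_mean eig b in auto)
      have conj: "ip01 (?y j) (efun (- int n)) = cnj (ip01 (?y j) (efun (int n)))" for j
        by (simp add: ip01_efun integral_cnj cnj_efun)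
      have uj: "u n j = ip01 (?y j) (efun (int n))" if "j \<in> {1, 2}" for j
        using u elim that by auto
      have "cmod (0 - (u n 1 * cnj (u n 2) + cnj (u n 1) * u n 2)) \<le> eps n"
        using integral_two_mode[OF q_L1 q_mean eig[of 1] b[of 1] y2.y_continuous b[of 2] y1.n_pos]
        unfolding orth[OF elim(3)] conj uj[symmetric] 
        by (simp add: eps_def ell_def d_def uj)
      moreover have "u n 1 * cnj (u n 2) + cnj (u n 1) * u n 2 = complex_of_real (2 * Re (u n 1 * cnj (u n 2)))"
        using complex_add_cnj[of "u n 1 * cnj (u n 2)"] by simp
      ultimately have "\<bar>2 * Re (u n 1 * cnj (u n 2))\<bar> \<le> eps n"
        by (simp only: diff_0 norm_minus_cancel norm_of_real)
      moreover have "cmod (u n 1) \<le> 4" "cmod (u n 2) \<le> 4"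
        using y1.u_bound[of "int n"] y2.u_bound[of "int n"] uj by auto
      ultimately show ?case by blast
    qed
    \<comment> \<open>\<open>132 = 4 + 128\<close>: the errors in \<open>|d n j|\<close> and in \<open>d n 1 + d n 2\<close> together stay below \<open>w n\<close>\<close>
    have small: "\<forall>\<^sub>F n in sequentially. 132 * (cmod (alpha n 1) + cmod (alpha n 2)) < w n"
    proof -
      have "\<forall>\<^sub>F n in sequentially. (cmod (alpha n 1) + cmod (alpha n 2)) / cmod (qcoeff q (2 * int n)) < 1 / 132"
        by (rule order_tendstoD(2)[OF dom]) simp
      thus ?thesis using nz by eventually_elim (simp add: w_def field_simps)
    qed
    have "\<forall>\<^sub>F n in sequentially. eps n < 1 / 16"
      by (rule order_tendstoD(2)[OF eps0]) simp
    hence split: "\<forall>\<^sub>F n in sequentially. d n 1 < d n 2 \<and>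
        \<bar>d n 1 + w n\<bar> \<le> 4 * cmod (alpha n 1) \<and> \<bar>d n 2 - w n\<bar> \<le> 4 * cmod (alpha n 2)"
      using Re_bound small lower[OF j1] lower[OF j2]
        modulus[OF j1] modulus[OF j2] eventually_ge_at_top[of N0]
    proof eventually_elim
      case (elim n)
      have eq: "complex_of_real (d n j) * u n j = qcoeff q (2 * int n) * cnj (u n j) + alpha n j"
        if "j \<in> {1, 2}" for j
        unfolding d_def using alpha elim that by blast
      have re: "\<bar>2 * Re (u n 1 * cnj (u n 2))\<bar> \<le> eps n" using elim by blast
      have sum: "\<bar>d n 1 + d n 2\<bar> \<le> 128 * (cmod (alpha n 1) + cmod (alpha n 2))"
      proof (rule coupling_sum[OF eq eq])
        show "\<bar>Re (u n 1 * cnj (u n 2))\<bar> \<le> 1 / 32"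
          using re elim(1) unfolding abs_mult by simp
      qed (use elim in auto)
      have "d n 1 \<le> d n 2" using ordered elim by (simp add: d_def)
      with opposite_signs[OF elim(6,7) sum] elim(3) show ?case by auto
    qed

    have asymptotics: "(\<lambda>n. lam n j - ((2 * pi * real n)\<^sup>2 + (-1) ^ j * cmod (qcoeff q (2 * int n))))
                   \<in> o(\<lambda>n. 1 / real n)" if j: "j \<in> {1, 2}" for j
    proof -
      have "(\<lambda>n. cmod (alpha n j)) \<in> o(\<lambda>n. 1 / real n)"
      proof (rule smalloI_tendsto)
        show "(\<lambda>n. cmod (alpha n j) / (1 / real n)) \<longlonglongrightarrow> 0"
          using na0[OF j] by (simp add: mult.commute)
        show "\<forall>\<^sub>F n in sequentially. 1 / real n \<noteq> 0"
          using eventually_gt_at_top[of 0] by eventually_elim simp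
      qed
      moreover have "(\<lambda>n. lam n j - ((2 * pi * real n)\<^sup>2 + (-1) ^ j * cmod (qcoeff q (2 * int n))))
          \<in> O(\<lambda>n. cmod (alpha n j))"
      proof (rule bigoI[where c = 4])
        show "\<forall>\<^sub>F n in sequentially. norm (lam n j - ((2 * pi * real n)\<^sup>2 + (-1) ^ j * cmod (qcoeff q (2 * int n))))
            \<le> 4 * norm (cmod (alpha n j))"
          using split
        proof eventually_elim
          case (elim n)
          have "lam n j - ((2 * pi * real n)\<^sup>2 + (-1) ^ j * cmod (qcoeff q (2 * int n))) = d n j - (-1) ^ j * w n"
            by (simp add: d_def w_def)
          thus ?case using elim j by auto
        qed
      qed
      ultimately show ?thesis by (rule landau_o.big_small_trans[rotated])
    qed

    have simple: "\<exists>N\<ge>N0. \<forall>n\<ge>N. \<forall>j\<in>{1, 2}. eig_mult q (lam n j) = 1"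
    proof -
      obtain M where M: "\<And>n j. n \<ge> N0 \<Longrightarrow> j \<in> {1, 2} \<Longrightarrow> lam n j > M"
        and mult: "\<And>mu. mu > M \<Longrightarrow> eig_mult q mu = card {(n, j). n \<ge> N0 \<and> j \<in> {1, 2} \<and> lam n j = mu}"
        using lam unfolding large_periodic_eigenvalues_def by blast
      have "\<forall>\<^sub>F n in sequentially. \<bar>d n j\<bar> < 1" if "j \<in> {1, 2}" for j
        using order_tendstoD(2)[OF tendsto_rabs_zero[OF d0[OF that]], of 1] by simp
      from this[OF j1] this[OF j2]
      have "\<forall>\<^sub>F n in sequentially. n \<ge> N0 \<and> (\<forall>j\<in>{1, 2}. \<bar>d n j\<bar> < 1) \<and> d n 1 < d n 2"
        using split eventually_ge_at_top[of N0] by eventually_elim blast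
      then obtain N1 where N1: "\<And>n. n \<ge> N1 \<Longrightarrow> n \<ge> N0 \<and> (\<forall>j\<in>{1, 2}. \<bar>d n j\<bar> < 1) \<and> d n 1 < d n 2"
        unfolding eventually_sequentially by blast
      \<comment> \<open>the finitely many eigenvalues of small index; those of large index exceed all of them\<close>
      define S where "S = (\<lambda>(n, j). lam n j) ` ({..<N1} \<times> {1, 2})"
      have "finite S" unfolding S_def by auto
      obtain N2 :: nat where N2: "real N2 > Max (insert 0 S) + 1" using reals_Archimedean2 by blast
      have lam_large: "lam n j > real n - 1" if n: "n \<ge> N1" "n > 0" and j: "j \<in> {1, 2}" for n j
      proof -
        have "real n \<le> (2 * pi * real n)\<^sup>2"
        proof -
          have t: "1 * real n \<le> 2 * pi * real n"
            using pi_ge_two by (intro mult_right_mono) auto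
          also have "\<dots> \<le> (2 * pi * real n)\<^sup>2"
          proof (rule self_le_power)
            have "1 \<le> 1 * real n" using n by simp
            thus "1 \<le> 2 * pi * real n" using t by (rule order_trans)
          qed simp
          finally show ?thesis by simp
        qed
        thus ?thesis using N1[OF n(1)] j by (auto simp: d_def)
      qed
      have same: "m = n \<and> i = j" if nm: "n \<ge> max N1 (N2 + 1)" "m \<ge> N0" and ij: "i \<in> {1, 2}" "j \<in> {1, 2}"
        and eq: "lam m i = lam n j" for m n i j
      proof -
        have n: "n \<ge> N1" "n > N2" "n > 0" using nm by auto
        have "m \<ge> N1"
        proof (rule ccontr)
          assume "\<not> m \<ge> N1"
          hence "lam m i \<in> S" using ij by (auto simp: S_def)
          hence "lam m i \<le> Max (insert 0 S)" using \<open>finite S\<close> by simp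
          also have "\<dots> < real n - 1" using N2 n by simp
          also have "\<dots> < lam n j" using lam_large n ij by blast
          finally show False using eq by simp
        qed
        have close: "\<bar>(2 * pi * real m)\<^sup>2 - (2 * pi * real n)\<^sup>2\<bar> < 2"
        proof -
          have "\<bar>d m i\<bar> < 1" "\<bar>d n j\<bar> < 1" using N1 \<open>m \<ge> N1\<close> n ij by blast+
          thus ?thesis using eq unfolding d_def by linarith
        qed
        have mn: "m = n"
        proof (rule ccontr)
          assume "m \<noteq> n"
          hence "1 \<le> \<bar>real m - real n\<bar>" by linarith
          moreover have "1 \<le> real m + real n" using n by simp
          moreover have "16 \<le> 4 * pi\<^sup>2" using power_mono[OF pi_ge_two, of 2] by simp
          ultimately have "16 * (1 * 1) \<le> 4 * pi\<^sup>2 * (\<bar>real m - real n\<bar> * (real m + real n))"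
            by (intro mult_mono) auto
          also have "\<dots> = \<bar>(2 * pi * real m)\<^sup>2 - (2 * pi * real n)\<^sup>2\<bar>"
          proof -
            have "(2 * pi * real m)\<^sup>2 - (2 * pi * real n)\<^sup>2 = 4 * pi\<^sup>2 * ((real m - real n) * (real m + real n))"
              by (simp add: power2_eq_square algebra_simps)
            thus ?thesis by (simp only: abs_mult) simp
          qed
          finally show False using close by simp
        qed
        have "lam n 1 < lam n 2" using N1[OF n(1)] by (simp add: d_def)
        hence "i = j" using eq ij mn by auto
        with mn show ?thesis by simp
      qed
      show ?thesis
      proof (intro exI[of _ "max N1 (N2 + 1)"] conjI allI impI ballI)
        show "N0 \<le> max N1 (N2 + 1)" using N1[of N1] by auto
        fix n j :: nat assume n: "n \<ge> max N1 (N2 + 1)" and j: "j \<in> {1, 2}"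
        have nN0: "n \<ge> N0" using N1[of n] n by auto
        have "{(m, i). m \<ge> N0 \<and> i \<in> {1, 2} \<and> lam m i = lam n j} = {(n, j)}"
          using same[OF n _ _ j] nN0 j by blast
        thus "eig_mult q (lam n j) = 1" using mult[OF M[OF nN0 j]] by simp
      qed
    qed
    show ?thesis using simple asymptotics by blast
  qed

  have "\<forall>n j. a n j \<in> {1, -1}" by (simp add: a_def)
  with part_a part_b show ?thesis by blast
qed

end
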